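(* Let $D$ be a Jordan domain in $\mathbb C$ and let $\lambda:\partial D\to\mathbb C$ with $|\lambda(\zeta)|=1$ for all $\zeta\in\partial D$, and $\varphi:\partial D\to\mathbb R$ be functions measurable with respect to harmonic measures in $D$. Then there exists an analytic function $f:D\to\mathbb C$ such that for almost every $\zeta\in\partial D$ with respect to harmonic measures in $D$, the function $\Omega_\zeta(z)=\mathrm{Re}\,\{\overline{\lambda(\zeta)}\cdot f(z)\}$ has a unique principal asymptotic value at $\zeta$, and it equals $\varphi(\zeta)$; i.e. $\lim_{z\to\zeta}\mathrm{Re}\,\{\overline{\lambda(\zeta)} f(z)\}=\varphi(\zeta)$ in the sense of the unique principal asymptotic value.
   Context: Let $\omega:D\to\mathbb D$ be a conformal map onto the unit disk, extended (by Carathéodory's theorem) to a homeomorphism $\overline D\to\overline{\mathbb D}$. A set $\mathcal E\subseteq\partial D$ is measurable with respect to harmonic measures in $D$ if $\omega(\mathcal E)$ is Lebesgue (arc length) measurable on $\partial\mathbb D$; it has harmonic measure zero if $|\omega(\mathcal E)|=0$ (this does not depend on the choice of $\omega$); a function $\psi$ on $\partial D$ is measurable with respect to harmonic measures if $\psi\circ\omega^{-1}$ is Lebesgue measurable on $\partial\mathbb D$, and "almost every with respect to harmonic measures" means outside a set of harmonic measure zero. For a function $\Omega:D\to\overline{\mathbb C}$, a point $\zeta\in\partial D$ and an arc $\gamma$ in $D$ terminating at $\zeta$, the cluster set is $C(\Omega,\gamma)=\{w\in\overline{\mathbb C}: \Omega(z_n)\to w \text{ for some } z_n\in\gamma,\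 z_n\to\zeta\}$. The set of principal asymptotic values of $\Omega$ at $\zeta$ is $P(\Omega,\zeta)=\bigcap_\gamma C(\Omega,\gamma)$, the intersection over all arcs $\gamma$ in $D$ terminating at $\zeta$. "Unique principal asymptotic value equal to $c$" means $P(\Omega,\zeta)=\{c\}$. *)

theory Defs
  imports "HOL-Analysis.Analysis"
begin

definition jordan_domain :: "complex set \<Rightarrow> bool" where
  "jordan_domain D \<longleftrightarrow>
     (\<exists>c. simple_path c \<and> pathfinish c = pathstart c \<and> D = inside (path_image c))"

definition conformal_ext_map :: "complex set \<Rightarrow> (complex \<Rightarrow> complex) \<Rightarrow> bool" where
  "conformal_ext_map D \<omega> \<longleftrightarrow>
     \<omega> holomorphic_on D \<and> inj_on \<omega> D \<and> \<omega> ` D = ball 0 1 \<and>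
     (\<exists>g. homeomorphism (closure D) (cball 0 1) \<omega> g)"

text \<open>Sets of harmonic measure zero: the image on the unit circle has arc-length measure zero
  (arc length on the circle is parametrised by t in [0, 2 pi] via cis t).\<close>
definition harm_null :: "complex set \<Rightarrow> (complex \<Rightarrow> complex) \<Rightarrow> complex set \<Rightarrow> bool" where
  "harm_null D \<omega> N \<longleftrightarrow> {t\<in>{0..2*pi}. cis t \<in> \<omega> ` N} \<in> null_sets lebesgue"

definition harm_measurable_fun ::
  "complex set \<Rightarrow> (complex \<Rightarrow> complex) \<Rightarrow> (complex \<Rightarrow> 'b::topological_space) \<Rightarrow> bool" where
  "harm_measurable_fun D \<omega> \<psi> \<longleftrightarrow>
     (\<lambda>t. \<psi> (inv_into (closure D) \<omega> (cis t))) \<in> borel_measurable (lebesgue_on {0..2*pi})"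

definition tends_ext :: "(nat \<Rightarrow> complex) \<Rightarrow> complex option \<Rightarrow> bool" where
  "tends_ext s w = (case w of None \<Rightarrow> filterlim s at_infinity sequentially
                             | Some c \<Rightarrow> s \<longlonglongrightarrow> c)"

definition arc_to :: "complex set \<Rightarrow> complex \<Rightarrow> (real \<Rightarrow> complex) \<Rightarrow> bool" where
  "arc_to D \<zeta> \<gamma> \<longleftrightarrow> arc \<gamma> \<and> pathfinish \<gamma> = \<zeta> \<and> \<gamma> ` {0..<1} \<subseteq> D"

definition cluster_set_arc ::
  "(complex \<Rightarrow> complex) \<Rightarrow> complex \<Rightarrow> (real \<Rightarrow> complex) \<Rightarrow> complex option set" where
  "cluster_set_arc \<Omega> \<zeta> \<gamma> =
     {w. \<exists>z. (\<forall>n. z n \<in> \<gamma> ` {0..<1}) \<and> z \<longlonglongrightarrow> \<zeta> \<and> tends_ext (\<lambda>n. \<Omega> (z n)) w}"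

definition principal_asymptotic_values ::
  "(complex \<Rightarrow> complex) \<Rightarrow> complex set \<Rightarrow> complex \<Rightarrow> complex option set" where
  "principal_asymptotic_values \<Omega> D \<zeta> = (\<Inter>{cluster_set_arc \<Omega> \<zeta> \<gamma> | \<gamma>. arc_to D \<zeta> \<gamma>})"

end

theory Submission
  imports Defs "HOL-Complex_Analysis.Complex_Analysis" "HOL-Real_Asymp.Real_Asymp"
begin

text \<open>Along radii, unlike nontangentially, the boundary values of an analytic function can be
  prescribed freely: given a measurable \<open>h\<close> on the circle there is \<open>F\<close> analytic in the disk with
  radial limit \<open>h\<close> almost everywhere. One takes \<open>F = \<Sum> G\<^sub>n\<close>, where \<open>G\<^sub>n\<close> is tiny on a large disk,
  close on the circle to the error \<open>h\<^sub>n - \<Sum>\<^bsub>i<n\<^esub> G\<^sub>i\<close> (with \<open>h\<^sub>n\<close> continuous, \<open>h\<^sub>n \<rightarrow> h\<close>)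
  outside a small set of arguments, and bounded by a multiple of that error along the remaining
  radii. Such a \<open>G\<^sub>n(z)\<close> is a Laurent polynomial times \<open>H(z\<^sup>N)\<close>, where \<open>H\<close> is entire and close to
  \<open>exp (- a / sqrt (z + \<sigma>))\<close>: this function is bounded by 1 off the slit \<open>(-\<infinity>, -\<sigma>]\<close>, tiny
  near 0 and close to 1 on the unit circle.

  The extension of \<open>F\<close> by \<open>h\<close> is moreover continuous on unions \<open>Y\<close> of closed radii over sets \<open>X\<close>
  exhausting the circle up to measure zero. Any curve ending at a point over a two-sided
  accumulation point of \<open>X\<close> meets \<open>Y\<close> arbitrarily late, so the radial limit lies in its cluster
  set. With \<open>h = \<lambda> \<phi>\<close> and transport by \<open>\<omega>\<close> this determines the principal asymptotic values.\<close>

section \<open>Approximation by entire functions\<close>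

text \<open>The approximants are entire functions instead of polynomials because this class is
  visibly stable under sums and compositions.\<close>

definition entire_approximable :: "complex set \<Rightarrow> (complex \<Rightarrow> complex) \<Rightarrow> bool" where
  "entire_approximable K f \<longleftrightarrow>
     (\<forall>e>0. \<exists>p. p holomorphic_on UNIV \<and> (\<forall>z\<in>K. norm (f z - p z) < e))"

lemma entire_approximable_holomorphic:
  "f holomorphic_on UNIV \<Longrightarrow> entire_approximable K f"
  unfolding entire_approximable_def by (metis cancel_comm_monoid_add_class.diff_cancel norm_zero)

lemma entire_approximable_cong:
  assumes "entire_approximable K f" "\<And>z. z \<in> K \<Longrightarrow> f z = g z"
  shows "entire_approximable K g"
  using assms unfolding entire_approximable_def by fastforce

lemma entire_approximable_mono:
  assumes "entire_approximable K f" "L \<subseteq> K"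
  shows "entire_approximable L f"
  using assms unfolding entire_approximable_def by blast

lemma entire_approximable_add:
  assumes "entire_approximable K f" "entire_approximable K g"
  shows "entire_approximable K (\<lambda>z. f z + g z)"
  unfolding entire_approximable_def
proof (intro allI impI)
  fix e :: real assume "e > 0"
  then have "e/2 > 0" by simp
  then obtain p q where p: "p holomorphic_on UNIV" "\<forall>z\<in>K. norm (f z - p z) < e/2"
    and q: "q holomorphic_on UNIV" "\<forall>z\<in>K. norm (g z - q z) < e/2"
    using assms unfolding entire_approximable_def by meson
  have "norm (f z + g z - (p z + q z)) < e" if "z \<in> K" for z
    using p(2) q(2) that norm_diff_triangle_ineq[of "f z" "g z" "p z" "q z"] by force
  then show "\<exists>p. p holomorphic_on UNIV \<and> (\<forall>z\<in>K. norm (f z + g z - p z) < e)"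
    by (intro exI[of _ "\<lambda>z. p z + q z"]) (auto intro!: holomorphic_intros p q)
qed

text \<open>The gap between \<open>r\<close> and \<open>R\<close> leaves room: an approximant of
  \<open>f\<close> with error below \<open>R - r\<close> still takes its values in
  \<open>cball 0 R\<close>, where the approximant of \<open>g\<close> is uniformly
  continuous.\<close>

lemma entire_approximable_compose:
  assumes f: "entire_approximable K f" and g: "entire_approximable (cball 0 R) g"
    and fK: "\<And>z. z \<in> K \<Longrightarrow> norm (f z) \<le> r" and "r < R"
  shows "entire_approximable K (\<lambda>z. g (f z))"
  unfolding entire_approximable_def
proof (intro allI impI)
  fix e :: real assume "e > 0"
  then have "e/2 > 0" by simp
  then obtain P where P: "P holomorphic_on UNIV" "\<And>w. norm w \<le> R \<Longrightarrow> norm (g w - P w) < e/2"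
    using g unfolding entire_approximable_def by (metis mem_cball_0)
  have "continuous_on (cball 0 R) P"
    using P(1) holomorphic_on_imp_continuous_on holomorphic_on_subset by blast
  then have "uniformly_continuous_on (cball 0 R) P"
    using compact_uniformly_continuous compact_cball by blast
  then obtain d where d: "d > 0"
    "\<And>x y. norm x \<le> R \<Longrightarrow> norm y \<le> R \<Longrightarrow> dist x y < d \<Longrightarrow> dist (P x) (P y) < e/2"
    using \<open>e/2 > 0\<close> unfolding uniformly_continuous_on_def by (metis mem_cball_0)
  have "min d (R - r) > 0" using d \<open>r < R\<close> by auto
  then obtain p where p: "p holomorphic_on UNIV"
    "\<And>z. z \<in> K \<Longrightarrow> norm (f z - p z) < min d (R - r)"
    using f unfolding entire_approximable_def by meson
  have "norm (g (f z) - P (p z)) < e" if "z \<in> K" for z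
  proof -
    have 1: "norm (f z) \<le> R" using fK[OF that] \<open>r < R\<close> by auto
    have "norm (p z) \<le> norm (f z) + norm (f z - p z)"
      by (metis norm_minus_commute norm_triangle_sub)
    then have 2: "norm (p z) \<le> R" using fK[OF that] p(2)[OF that] by auto
    have "dist (P (f z)) (P (p z)) < e/2"
      using d(2)[OF 1 2] p(2)[OF that] by (auto simp: dist_norm)
    then show ?thesis
      using P(2)[OF 1] norm_triangle_lt[of "g (f z) - P (f z)" "P (f z) - P (p z)" e]
      by (auto simp: dist_norm)
  qed
  moreover have "(\<lambda>z. P (p z)) holomorphic_on UNIV"
    using holomorphic_on_compose[OF p(1), of P] P(1) holomorphic_on_subset
    by (auto simp: o_def)
  ultimately show "\<exists>p. p holomorphic_on UNIV \<and> (\<forall>z\<in>K. norm (g (f z) - p z) < e)"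
    by blast
qed

lemma entire_approximable_cball:
  assumes g: "g holomorphic_on ball 0 R" and "r < R"
  shows "entire_approximable (cball 0 r) g"
proof (cases "0 \<le> r")
  case False
  then show ?thesis by (auto simp: entire_approximable_def intro: exI[of _ "\<lambda>_. 0"])
next
  case True
  define a where "a n = (deriv ^^ n) g 0 / fact n" for n
  have sums: "(\<lambda>n. a n * z ^ n) sums g z" if "norm z < R" for z :: complex
    using holomorphic_power_series[OF g, of z] that by (simp add: a_def)
  \<comment> \<open>The midpoint of \<open>r\<close> and \<open>R\<close>: convergence of the Taylor
    series at \<open>s\<close> makes the radius of convergence strictly larger than
    \<open>r\<close>, hence the convergence uniform on \<open>cball 0 r\<close>.\<close>
  define s where "s = (r + R) / 2"
  have "summable (\<lambda>n. a n * of_real s ^ n)"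
  proof -
    have "norm (of_real s :: complex) < R"
      unfolding norm_of_real using \<open>r < R\<close> True by (auto simp: s_def)
    then show ?thesis using sums sums_summable by blast
  qed
  then have "conv_radius a \<ge> norm (of_real s :: complex)"
    by (rule conv_radius_geI)
  moreover have "norm (of_real s :: complex) > r"
    unfolding norm_of_real using \<open>r < R\<close> True by (auto simp: s_def)
  ultimately have "ereal r < conv_radius a"
    by (meson ereal_less(2) less_ereal.simps(1) order_less_le_trans)
  from powser_uniform_limit[OF this, of 0]
  have lim: "uniform_limit (cball 0 r) (\<lambda>n x. \<Sum>i<n. a i * x ^ i) (\<lambda>x. suminf (\<lambda>i. a i * x ^ i)) sequentially"
    by simp
  show ?thesis
    unfolding entire_approximable_def
  proof (intro allI impI)
    fix e :: real assume "e > 0"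
    then obtain n where n: "\<forall>x\<in>cball 0 r. dist (\<Sum>i<n. a i * x ^ i) (suminf (\<lambda>i. a i * x ^ i)) < e"
      using uniform_limitD[OF lim \<open>e > 0\<close>] by (auto simp: eventually_sequentially)
    show "\<exists>p. p holomorphic_on UNIV \<and> (\<forall>z\<in>cball 0 r. norm (g z - p z) < e)"
    proof (intro exI conjI ballI)
      show "(\<lambda>x. \<Sum>i<n. a i * x ^ i) holomorphic_on UNIV"
        by (intro holomorphic_intros)
      fix z :: complex assume z: "z \<in> cball 0 r"
      then have "suminf (\<lambda>i. a i * z ^ i) = g z"
        using sums[of z] \<open>r < R\<close> by (auto simp: sums_iff)
      then show "norm (g z - (\<Sum>i<n. a i * z ^ i)) < e"
        using n z by (metis dist_commute dist_norm)
    qed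
  qed
qed

lemma entire_approximable_compose_entire:
  assumes "entire_approximable K f" "bounded (f ` K)" "g holomorphic_on UNIV"
  shows "entire_approximable K (\<lambda>z. g (f z))"
proof -
  obtain B where "\<And>z. z \<in> K \<Longrightarrow> norm (f z) \<le> B"
    using assms(2) by (auto simp: bounded_iff)
  then show ?thesis
    by (intro entire_approximable_compose[OF assms(1) entire_approximable_holomorphic[OF assms(3)]
          , of B "B + 1"]) auto
qed

section \<open>Logarithms with a movable branch point\<close>

text \<open>Both sides are logarithms of \<open>w - d\<close>, so only the branch is at stake. As
  \<open>d\<close> is real and nonnegative, \<open>w\<close>, \<open>w - d\<close> and
  \<open>1 - d / w\<close> have imaginary parts of the same sign, and \<open>1 - d / w\<close> lies
  in the right half-plane; the arguments therefore cannot differ by a full turn.\<close>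

lemma Ln_shift:
  assumes "\<And>x. x \<le> 0 \<Longrightarrow> w \<noteq> of_real x" "norm (d / w) < 1" "d \<in> \<real>" "Re d \<ge> 0"
    "\<And>x. x \<le> 0 \<Longrightarrow> w - d \<noteq> of_real x"
  shows "Ln (w - d) = Ln w + Ln (1 - d / w)"
proof -
  have w0: "w \<noteq> 0" using assms(1)[of 0] by auto
  have "w - d \<noteq> 0" using assms(5)[of 0] by auto
  then have v0: "1 - d / w \<noteq> 0" using w0 by (simp add: field_simps)
  define D where "D = Re d"
  have d: "d = of_real D" "D \<ge> 0" using assms by (auto simp: D_def)
  have "w * (1 - d / w) = w - d" using w0 by (simp add: field_simps)
  moreover have "Im (Ln w) + Im (Ln (1 - d / w)) \<in> {-pi<..pi}"
  proof -
    have nn: "w \<notin> \<real>\<^sub>\<le>\<^sub>0" using assms(1) by (auto simp: nonpos_Reals_def)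
    then have w1: "\<bar>Im (Ln w)\<bar> < pi"
      using mpi_less_Im_Ln[OF w0] Im_Ln_less_pi[OF nn] by linarith
    have "Re (1 - d / w) > 0"
      using assms(2) abs_Re_le_cmod[of "d / w"] by auto
    then have v1: "\<bar>Im (Ln (1 - d / w))\<bar> < pi / 2" using Re_Ln_pos_lt v0 by auto
    show ?thesis
    proof (cases "Im w = 0")
      case True
      \<comment> \<open>For real \<open>w\<close> the factor \<open>1 - d / w\<close> is a positive
        real and contributes no argument.\<close>
      then have "Im (d / w) = 0" using d by (simp add: Im_divide)
      then have "Im (Ln (1 - d / w)) = 0"
        using \<open>Re (1 - d / w) > 0\<close> Im_Ln_eq_0[OF v0] by simp
      then show ?thesis using w1 by auto
    next
      case False
      have Imv: "Im (1 - d / w) = D * Im w / ((Re w)\<^sup>2 + (Im w)\<^sup>2)"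
        using d by (simp add: Im_divide)
      obtain k where k: "Ln (w - d) - (Ln w + Ln (1 - d / w)) = of_int (2 * k) * pi * \<i>"
      proof -
        have "exp (Ln (w - d)) = exp (Ln w + Ln (1 - d / w))"
          using w0 v0 \<open>w - d \<noteq> 0\<close> \<open>w * (1 - d / w) = w - d\<close> by (simp add: exp_add)
        then show ?thesis using that by (auto simp: exp_eq algebra_simps)
      qed
      have Imk: "Im (Ln (w - d)) - (Im (Ln w) + Im (Ln (1 - d / w))) = 2 * k * pi"
        using arg_cong[OF k, of Im] by simp
      have nn2: "w - d \<notin> \<real>\<^sub>\<le>\<^sub>0" using assms(5) by (auto simp: nonpos_Reals_def)
      have "k = 0"
      proof -
        consider "Im w > 0" | "Im w < 0" using False by linarith
        then have "\<bar>2 * real_of_int k * pi\<bar> < 2 * pi"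
        proof cases
          case 1
          have "Im (1 - d/w) \<ge> 0" using 1 Imv d by simp
          then have "Im (Ln (1 - d / w)) \<ge> 0" using Im_Ln_pos_le[OF v0] by blast
          moreover have "Im (Ln w) \<ge> 0" "Im (Ln (w - d)) \<ge> 0"
            using 1 Im_Ln_pos_le[OF w0] Im_Ln_pos_le[OF \<open>w - d \<noteq> 0\<close>] d by auto
          ultimately
          show ?thesis using w1 v1 Im_Ln_le_pi[of "w - d"] \<open>w - d \<noteq> 0\<close> Imk pi_gt_zero by linarith
        next
          case 2
          have "Im (1 - d/w) \<le> 0" using 2 Imv d by (simp add: divide_nonpos_nonneg mult_nonneg_nonpos)
          then have "Im (Ln (1 - d / w)) \<le> 0"
            using Im_Ln_pos_lt[OF v0] v1 by linarith
          moreover have "Im (Ln w) \<le> 0" "Im (Ln (w - d)) \<le> 0"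
            using 2 d Im_Ln_pos_lt[OF w0] Im_Ln_pos_lt[OF \<open>w - d \<noteq> 0\<close>] w1 nn2
              Im_Ln_less_pi[of "w-d"] Im_Ln_le_pi[of "w - d"] \<open>w - d \<noteq> 0\<close> Im_Ln_eq_pi[of "w-d"]
            by (auto simp: not_less[symmetric])
          ultimately show ?thesis using w1 v1 mpi_less_Im_Ln[OF \<open>w - d \<noteq> 0\<close>] Imk pi_gt_zero by linarith
        qed
        then have "\<bar>real_of_int k\<bar> < 1" by (simp add: abs_mult)
        then show ?thesis by linarith
      qed
      then show ?thesis using Imk mpi_less_Im_Ln[OF \<open>w - d \<noteq> 0\<close>] Im_Ln_le_pi[OF \<open>w - d \<noteq> 0\<close>] by auto
    qed
  qed
  ultimately show ?thesis
    using Ln_times_simple[OF w0 v0] by (metis greaterThanAtMost_iff plus_complex.simps(2))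
qed

text \<open>Pole pushing: the branch point is moved along the slit, starting far from \<open>K\<close>, in steps
  shorter than half the distance of \<open>K\<close> from the slit.\<close>

lemma entire_approximable_Ln:
  assumes K: "compact K" and "\<sigma> > 0"
    and slit: "\<And>x. x \<le> -\<sigma> \<Longrightarrow> complex_of_real x \<notin> K"
  shows "entire_approximable K (\<lambda>z. Ln (z + of_real \<sigma>))"
proof (cases "K = {}")
  case True
  then show ?thesis by (auto simp: entire_approximable_def intro: exI[of _ "\<lambda>_. 0"])
next
  case False
  define T where "T = complex_of_real ` {..-\<sigma>}"
  have T: "z \<in> T \<longleftrightarrow> z \<in> \<real> \<and> Re z \<le> -\<sigma>" for z
    by (auto simp: T_def Reals_def)
  have "closed T"
  proof -
    have "T = \<real> \<inter> {z. Re z \<le> -\<sigma>}" using T by auto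
    then show ?thesis by (simp add: closed_Int closed_complex_Reals closed_halfspace_Re_le)
  qed
  moreover have "K \<inter> T = {}" using slit by (auto simp: T_def)
  ultimately obtain m where m: "m > 0" "\<And>x y. x \<in> K \<Longrightarrow> y \<in> T \<Longrightarrow> m \<le> dist x y"
    using separate_compact_closed[OF K] by metis
  have far: "norm (z + of_real c) \<ge> m" if "z \<in> K" "c \<ge> \<sigma>" for z c
  proof -
    have "- complex_of_real c \<in> T" using that by (simp add: T)
    from m(2)[OF that(1) this] show ?thesis by (simp add: dist_norm)
  qed
  have off: "z + of_real c \<noteq> of_real x" if "z \<in> K" "c \<ge> \<sigma>" "x \<le> 0" for z c x
  proof
    assume "z + of_real c = of_real x"
    then have "z = of_real (x - c)" by (simp add: algebra_simps)
    then show False using slit[of "x - c"] that by simp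
  qed
  then have off': "z + of_real c \<notin> \<real>\<^sub>\<le>\<^sub>0" if "z \<in> K" "c \<ge> \<sigma>" for z c
    using that by (auto simp: nonpos_Reals_def)
  obtain R where R: "R > 0" "\<And>z. z \<in> K \<Longrightarrow> norm z \<le> R"
    using compact_imp_bounded[OF K] by (auto simp: bounded_pos)
  \<comment> \<open>Beyond \<open>R\<close> the branch point is outside the disk around 0 that
    contains \<open>K\<close>, so the Taylor approximation suffices.\<close>
  have base: "entire_approximable K (\<lambda>z. Ln (z + of_real c))" if "c > R" for c
  proof -
    have "z + of_real c \<notin> \<real>\<^sub>\<le>\<^sub>0" if "norm z < c" for z :: complex
      using that abs_Re_le_cmod[of z] by (auto simp: complex_nonpos_Reals_iff)
    then have "(\<lambda>z. Ln (z + of_real c)) holomorphic_on ball 0 c"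
      by (intro holomorphic_intros) auto
    then show ?thesis
      using entire_approximable_mono[OF entire_approximable_cball[OF _ that]] R(2)
      by (simp add: subset_iff)
  qed
  \<comment> \<open>The new logarithm is the old one plus \<open>Ln (1 - d / (z + c))\<close>. The
    second summand is a power series in \<open>1 / (z + c)\<close>, and this reciprocal is
    \<open>exp (- Ln (z + c))\<close>, hence approximable by the hypothesis on the old
    logarithm.\<close>
  have step: "entire_approximable K (\<lambda>z. Ln (z + of_real (c - d)))"
    if hyp: "entire_approximable K (\<lambda>z. Ln (z + of_real c))" and "c - d \<ge> \<sigma>" "0 < d" "2 * d \<le> m" for c d
  proof -
    have c: "c \<ge> \<sigma>" using that by simp
    have nz: "z + of_real c \<noteq> 0" if "z \<in> K" for z using off[OF that c, of 0] by simp
    have "continuous_on K (\<lambda>z. Ln (z + of_real c))"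
      using off'[OF _ c] by (intro continuous_intros) auto
    then have "bounded ((\<lambda>z. Ln (z + of_real c)) ` K)"
      using K compact_continuous_image compact_imp_bounded by blast
    then have "entire_approximable K (\<lambda>z. exp (- Ln (z + of_real c)))"
      by (intro entire_approximable_compose_entire[OF hyp, of "\<lambda>w. exp (- w)"] holomorphic_intros)
    then have inv: "entire_approximable K (\<lambda>z. 1 / (z + of_real c))"
      by (rule entire_approximable_cong) (use nz in \<open>auto simp: exp_minus inverse_eq_divide\<close>)
    have "1 - of_real d * w \<notin> \<real>\<^sub>\<le>\<^sub>0" if "norm w < 1 / d" for w :: complex
    proof -
      have "norm (of_real d * w) < 1" using that \<open>0 < d\<close> by (simp add: norm_mult field_simps)
      then show ?thesis using abs_Re_le_cmod[of "of_real d * w"] by (auto simp: complex_nonpos_Reals_iff)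
    qed
    then have hol: "(\<lambda>w. Ln (1 - of_real d * w)) holomorphic_on ball 0 (1 / d)"
      by (intro holomorphic_intros) auto
    \<comment> \<open>An intermediate radius: the reciprocal is bounded by \<open>1 / m\<close>, at
      most \<open>1 / (2 * d)\<close>, while the power series converges up to
      \<open>1 / d\<close>.\<close>
    have lt: "1 / m < 3 / (4 * d)" "3 / (4 * d) < 1 / d"
      using \<open>0 < d\<close> \<open>2 * d \<le> m\<close> m by (auto simp: field_simps)
    have small: "norm (1 / (z + of_real c)) \<le> 1 / m" if "z \<in> K" for z
      using far[OF that c] m by (simp add: norm_divide frac_le)
    have "entire_approximable K (\<lambda>z. Ln (1 - of_real d * (1 / (z + of_real c))))"
      by (rule entire_approximable_compose[OF inv entire_approximable_cball[OF hol lt(2)] small lt(1)])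
    from entire_approximable_add[OF hyp this]
    show ?thesis
    proof (rule entire_approximable_cong)
      fix z assume z: "z \<in> K"
      have "norm (of_real d / (z + of_real c)) < 1"
        using far[OF z c] \<open>0 < d\<close> \<open>2 * d \<le> m\<close> nz[OF z] by (simp add: norm_divide field_simps)
      then have "Ln (z + of_real c - of_real d) = Ln (z + of_real c) + Ln (1 - of_real d / (z + of_real c))"
        using off[OF z c] off[OF z \<open>c - d \<ge> \<sigma>\<close>] \<open>0 < d\<close>
        by (intro Ln_shift) (auto simp: algebra_simps)
      then show "Ln (z + of_real c) + Ln (1 - of_real d * (1 / (z + of_real c))) = Ln (z + of_real (c - d))"
        by (simp add: algebra_simps)
    qed
  qed
  \<comment> \<open>The starting shift exceeds \<open>R\<close>, and \<open>n\<close> equal steps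
    down to \<open>\<sigma>\<close> have length at most \<open>m / 2\<close>.\<close>
  define c0 where "c0 = \<sigma> + R + 1"
  obtain n :: nat where n: "real n > 2 * (c0 - \<sigma>) / m" using reals_Archimedean2 by blast
  have "0 < 2 * (c0 - \<sigma>) / m" using m R by (simp add: c0_def)
  then have "n > 0" using n by linarith
  define d where "d = (c0 - \<sigma>) / n"
  have d: "d > 0" "2 * d \<le> m" "c0 - real n * d = \<sigma>"
    using n m R \<open>n > 0\<close> by (auto simp: d_def c0_def field_simps)
  have "entire_approximable K (\<lambda>z. Ln (z + of_real (c0 - real k * d)))" if "k \<le> n" for k
    using that
  proof (induction k)
    case 0
    then show ?case using base[of c0] R \<open>\<sigma> > 0\<close> by (simp add: c0_def)
  next
    case (Suc k)
    have eq: "c0 - real k * d - d = c0 - real (Suc k) * d" by (simp add: algebra_simps)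
    have "real (Suc k) * d \<le> real n * d" using Suc.prems d by (intro mult_right_mono) auto
    then have "c0 - real k * d - d \<ge> \<sigma>" using d(3) eq by linarith
    from step[OF Suc.IH this d(1,2)] show ?case unfolding eq using Suc.prems by auto
  qed
  from this[of n] show ?thesis using d(3) by simp
qed

section \<open>An entire function close to a radial step\<close>

text \<open>The model is \<open>exp (- a / csqrt (z + \<sigma>))\<close>. First \<open>a\<close> is
  made small so that the exponent is small on the unit circle; then \<open>\<sigma>\<close>,
  depending on \<open>a\<close>, is made so small that the exponent has large real part near 0. The
  condition \<open>H 0 = 0\<close> will cancel a pole later.\<close>

lemma entire_step_function:
  assumes \<eta>: "0 < \<eta>" and \<epsilon>: "0 < \<epsilon>" "\<epsilon> \<le> 1"
  obtains \<rho> H where "\<rho> > 0" "H holomorphic_on UNIV" "H 0 = 0"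
    "\<And>z. norm z \<le> \<rho> \<Longrightarrow> norm (H z) \<le> \<epsilon>"
    "\<And>x \<theta>. 0 \<le> x \<Longrightarrow> x \<le> 1 \<Longrightarrow> 0 \<le> \<theta> \<Longrightarrow> \<theta> \<le> 2 * pi \<Longrightarrow> \<eta> \<le> \<bar>\<theta> - pi\<bar> \<Longrightarrow>
       norm (H (of_real x * cis \<theta>)) \<le> 2"
    "\<And>\<theta>. 0 \<le> \<theta> \<Longrightarrow> \<theta> \<le> 2 * pi \<Longrightarrow> \<eta> \<le> \<bar>\<theta> - pi\<bar> \<Longrightarrow> norm (H (cis \<theta>) - 1) \<le> \<epsilon>"
proof -
  \<comment> \<open>Near 0 both \<open>p z\<close> and \<open>p 0\<close> are at most
    \<open>2 * \<delta>\<close>; on the circle the model and its approximation each cost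
    \<open>\<delta>\<close> and the normalisation by \<open>p 0\<close> costs
    \<open>2 * \<delta>\<close>. Both totals are \<open>4 * \<delta>\<close>.\<close>
  define \<delta> where "\<delta> = \<epsilon> / 4"
  have \<delta>: "0 < \<delta>" "\<delta> < 1" using \<epsilon> by (auto simp: \<delta>_def)
  have "isCont (\<lambda>w::complex. exp (- w)) 0" by (intro continuous_intros)
  then obtain b where b: "b > 0" "\<And>w::complex. norm w < b \<Longrightarrow> norm (exp (- w) - 1) < \<delta>"
    using \<delta>(1) unfolding isCont_def LIM_eq
    by (metis add.inverse_neutral diff_zero exp_zero norm_zero cancel_comm_monoid_add_class.diff_cancel)
  \<comment> \<open>On the unit circle \<open>norm (z + \<sigma>)\<close> is at least 1/2, so the
    square root exceeds 1/2 in modulus and the exponent stays below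
    \<open>2 * a = b\<close>.\<close>
  define a where "a = b / 2"
  have a: "a > 0" using b by (simp add: a_def)
  \<comment> \<open>The second bound gives
    \<open>a\<^sup>2 / (3 * \<sigma>) \<ge> (ln \<delta>)\<^sup>2\<close>, which matches the
    estimate of the real part of the exponent on the disk of radius
    \<open>\<sigma> / 2\<close>.\<close>
  define \<sigma> where "\<sigma> = min (1/2) (a\<^sup>2 / (3 * (ln \<delta>)\<^sup>2))"
  have lnd: "ln \<delta> < 0" using \<delta> by simp
  have \<sigma>: "0 < \<sigma>" "\<sigma> \<le> 1/2" "3 * \<sigma> * (ln \<delta>)\<^sup>2 \<le> a\<^sup>2"
    using a lnd by (auto simp: \<sigma>_def min_def field_simps)
  \<comment> \<open>Written through \<open>Ln\<close>, the model is an entire function of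
    \<open>Ln (z + \<sigma>)\<close>, so its approximability follows by composition; the square root
    is recovered in \<open>sq\<close>.\<close>
  define V where "V z = of_real a * exp (- (Ln (z + of_real \<sigma>) / 2))" for z
  define H0 where "H0 z = exp (- V z)" for z
  \<comment> \<open>the disk and the radii on which \<open>H\<close> has to be controlled; the sector around the negative
    real axis is left out so that \<open>K\<close> avoids the slit\<close>
  define K where "K = cball 0 (\<sigma>/2) \<union>
    (\<lambda>(x,\<theta>). of_real x * cis \<theta>) ` ({0..1} \<times> ({0..2*pi} \<inter> ({..pi - \<eta>} \<union> {pi + \<eta>..})))"
  have Kcomp: "compact K"
    unfolding K_def
    by (intro compact_Un compact_cball compact_continuous_image compact_Times compact_Int_closed)
       (auto intro!: continuous_intros simp: case_prod_beta)
  have slit: "complex_of_real x \<notin> K" if "x \<le> -\<sigma>" for x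
  proof
    assume "complex_of_real x \<in> K"
    moreover have "x \<notin> cball 0 (\<sigma>/2)" using that \<sigma> by auto
    then have "complex_of_real x \<notin> cball 0 (\<sigma>/2)" by auto
    ultimately obtain y \<theta> where y: "0 \<le> y" "y \<le> 1" "0 \<le> \<theta>" "\<theta> \<le> 2 * pi" "\<theta> \<le> pi - \<eta> \<or> \<theta> \<ge> pi + \<eta>"
      "complex_of_real x = of_real y * cis \<theta>"
      by (auto simp: K_def)
    have "y * sin \<theta> = Im (of_real y * cis \<theta>)" "y * cos \<theta> = Re (of_real y * cis \<theta>)"
      by simp_all
    then have "y * sin \<theta> = 0" "y * cos \<theta> = x"
      by (simp_all flip: y(6) del: mult_eq_0_iff)
    moreover have "x < 0" using that \<sigma> by auto
    ultimately have "sin \<theta> = 0" "cos \<theta> < 0" 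
      using y(1) by (auto simp: mult_less_0_iff)
    then have "\<theta> \<noteq> 0" "\<theta> \<noteq> 2 * pi" "\<not> (0 < \<theta> \<and> \<theta> < pi)" "\<not> (pi < \<theta> \<and> \<theta> < 2 * pi)"
      using sin_gt_zero[of \<theta>] sin_lt_zero[of \<theta>] by auto
    then have "\<theta> = pi" using y(3,4) by linarith
    then show False using y(5) \<eta> by auto
  qed
  have Knz: "z + of_real \<sigma> \<notin> \<real>\<^sub>\<le>\<^sub>0" if "z \<in> K" for z
  proof
    assume "z + of_real \<sigma> \<in> \<real>\<^sub>\<le>\<^sub>0"
    then obtain x where x: "z + of_real \<sigma> = of_real x" "x \<le> 0" by (auto simp: nonpos_Reals_def)
    then have "z = of_real (x - \<sigma>)" by (simp add: algebra_simps)
    then show False using slit[of "x - \<sigma>"] x that by auto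
  qed
  have "continuous_on K (\<lambda>z. Ln (z + of_real \<sigma>))"
    using Knz by (intro continuous_intros) auto
  then have "bounded ((\<lambda>z. Ln (z + of_real \<sigma>)) ` K)"
    using Kcomp compact_continuous_image compact_imp_bounded by blast
  then have "entire_approximable K H0"
    unfolding H0_def V_def
    by (intro entire_approximable_compose_entire[OF entire_approximable_Ln[OF Kcomp \<sigma>(1) slit],
          of "\<lambda>w. exp (- (of_real a * exp (- (w / 2))))"] holomorphic_intros) auto
  then obtain p where p: "p holomorphic_on UNIV" "\<And>z. z \<in> K \<Longrightarrow> norm (H0 z - p z) < \<delta>"
    using \<delta> unfolding entire_approximable_def by meson
  define H where "H z = p z - p 0" for z
  have sq: "V z = of_real a / csqrt (z + of_real \<sigma>)" if "z \<in> K" for z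
  proof -
    have "z + of_real \<sigma> \<noteq> 0" using Knz[OF that] by auto
    then have "csqrt (z + of_real \<sigma>) = exp (Ln (z + of_real \<sigma>) / 2)" by (rule csqrt_exp_Ln)
    then show ?thesis by (simp add: V_def exp_minus field_simps)
  qed
  have Re_csqrt: "Re (1 / csqrt w) = Re (csqrt w) / norm w" for w
  proof -
    have "Re (1 / csqrt w) = Re (csqrt w) / (norm (csqrt w))\<^sup>2"
      unfolding cmod_power2 by (simp add: Re_divide del: csqrt.sel)
    moreover have "(norm (csqrt w))\<^sup>2 = norm w" by (metis norm_power power2_csqrt)
    ultimately show ?thesis by metis
  qed
  have Re_V: "Re (V z) = a * (Re (csqrt (z + of_real \<sigma>)) / norm (z + of_real \<sigma>))" if "z \<in> K" for z
  proof -
    have "V z = a *\<^sub>R (1 / csqrt (z + of_real \<sigma>))" using sq[OF that] by (simp add: scaleR_conv_of_real)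
    then show ?thesis by (simp only: scaleR_complex.sel Re_csqrt)
  qed
  have H0_le: "norm (H0 z) \<le> 1" if "z \<in> K" for z
  proof -
    have "Re (csqrt (z + of_real \<sigma>)) \<ge> 0" using csqrt_principal[of "z + of_real \<sigma>"] by linarith
    then have "Re (V z) \<ge> 0" using a unfolding Re_V[OF that] by simp
    then show ?thesis by (simp add: H0_def)
  qed
  have H0_small: "norm (H0 z) \<le> \<delta>" if "norm z \<le> \<sigma>/2" for z
  proof -
    define w where "w = z + of_real \<sigma>"
    have z: "z \<in> K" using that by (auto simp: K_def)
    have "\<bar>Re z\<bar> \<le> \<sigma>/2" using that abs_Re_le_cmod[of z] by linarith
    then have "Re w > 0" using \<sigma> by (auto simp: w_def)
    then have w0: "norm w > 0" by auto
    have "norm w \<le> 3 * \<sigma> / 2" unfolding w_def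
      using that norm_triangle_ineq[of z "of_real \<sigma>"] \<sigma> by auto
    have "0 \<le> norm w + Re w" using \<open>Re w > 0\<close> norm_ge_zero[of w] by linarith
    then have "(Re (csqrt w))\<^sup>2 = (norm w + Re w) / 2" by simp
    also have "\<dots> \<ge> norm w / 2" using \<open>Re w > 0\<close> by simp
    finally have "(Re (csqrt w))\<^sup>2 \<ge> norm w / 2" .
    \<comment> \<open>This quotient is the real part of \<open>1 / csqrt w\<close>; its square is at
      least \<open>1 / (2 * norm w)\<close>, where \<open>norm w\<close> is at most
      \<open>3 * \<sigma> / 2\<close>.\<close>
    then have "(Re (csqrt w) / norm w)\<^sup>2 \<ge> (norm w / 2) / (norm w)\<^sup>2"
      unfolding power_divide by (intro divide_right_mono) auto
    also have "(norm w / 2) / (norm w)\<^sup>2 = 1 / (2 * norm w)" using w0 by (simp add: power2_eq_square)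
    also have "1 / (2 * norm w) \<ge> 1 / (3 * \<sigma>)" using \<open>norm w \<le> 3 * \<sigma> / 2\<close> w0 \<sigma>(1) by (intro divide_left_mono) auto
    finally have "a\<^sup>2 * (Re (csqrt w) / norm w)\<^sup>2 \<ge> a\<^sup>2 * (1 / (3 * \<sigma>))"
      by (rule mult_left_mono) simp
    moreover have "a\<^sup>2 * (1 / (3 * \<sigma>)) \<ge> (ln \<delta>)\<^sup>2" using \<sigma> by (simp add: field_simps)
    ultimately have "(a * (Re (csqrt w) / norm w))\<^sup>2 \<ge> (- ln \<delta>)\<^sup>2"
      unfolding power_mult_distrib power2_minus by linarith
    moreover have "a * (Re (csqrt w) / norm w) \<ge> 0"
      using a csqrt_principal[of w] by (intro mult_nonneg_nonneg divide_nonneg_nonneg norm_ge_zero) linarith+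
    ultimately have "a * (Re (csqrt w) / norm w) \<ge> - ln \<delta>"
      by (rule power2_le_imp_le)
    then have "- Re (V z) \<le> ln \<delta>" unfolding Re_V[OF z] w_def by linarith
    then have "exp (- Re (V z)) \<le> exp (ln \<delta>)" by simp
    then show ?thesis using \<delta> by (simp add: H0_def)
  qed
  have H0_one: "norm (H0 z - 1) < \<delta>" if "z \<in> K" "norm z = 1" for z
  proof -
    have "norm (z + of_real \<sigma>) \<ge> 1/2"
      using norm_diff_ineq[of z "of_real \<sigma>"] that \<sigma> by auto
    then have "(1/2)\<^sup>2 < norm (z + of_real \<sigma>)" by (simp add: power2_eq_square)
    then have "norm (csqrt (z + of_real \<sigma>)) > 1/2" unfolding norm_csqrt by (rule real_less_rsqrt)
    then have "a / norm (csqrt (z + of_real \<sigma>)) < a / (1/2)"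
      using a by (intro divide_strict_left_mono mult_pos_pos) linarith+
    then have "norm (V z) < b" using a unfolding sq[OF that(1)] norm_divide by (simp add: a_def)
    then show ?thesis using b(2) by (simp add: H0_def)
  qed
  have p_small: "norm (p z) \<le> 2 * \<delta>" if "norm z \<le> \<sigma>/2" for z
  proof -
    have "z \<in> K" using that by (auto simp: K_def)
    then show ?thesis using H0_small[OF that] p(2)[of z] norm_triangle_sub[of "p z" "H0 z"]
      by (simp add: norm_minus_commute)
  qed
  have p0: "norm (p 0) \<le> 2 * \<delta>" using p_small[of 0] \<sigma> by simp
  have in_K: "of_real x * cis \<theta> \<in> K" if "0 \<le> x" "x \<le> 1" "0 \<le> \<theta>" "\<theta> \<le> 2 * pi" "\<eta> \<le> \<bar>\<theta> - pi\<bar>" for x \<theta>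
    unfolding K_def using that
    by (intro UnI2 image_eqI[of _ _ "(x,\<theta>)"]) (auto simp: abs_if split: if_splits)
  show ?thesis
  proof (rule that[of "\<sigma>/2" H])
    show "\<sigma>/2 > 0" "H 0 = 0" using \<sigma> by (auto simp: H_def)
    show "H holomorphic_on UNIV" unfolding H_def by (intro holomorphic_intros p)
  next
    fix z :: complex assume "norm z \<le> \<sigma>/2"
    then show "norm (H z) \<le> \<epsilon>"
      using p_small[of z] p0 norm_triangle_ineq4[of "p z" "p 0"] by (simp add: H_def \<delta>_def)
  next
    fix x \<theta> :: real assume "0 \<le> x" "x \<le> 1" "0 \<le> \<theta>" "\<theta> \<le> 2 * pi" "\<eta> \<le> \<bar>\<theta> - pi\<bar>"
    then have "of_real x * cis \<theta> \<in> K" by (rule in_K)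
    from H0_le[OF this] p(2)[OF this] show "norm (H (of_real x * cis \<theta>)) \<le> 2"
      using p0 norm_triangle_ineq4[of "p (of_real x * cis \<theta>)" "p 0"] \<epsilon>
        norm_triangle_sub[of "p (of_real x * cis \<theta>)" "H0 (of_real x * cis \<theta>)"]
      by (simp add: H_def \<delta>_def norm_minus_commute)
  next
    fix \<theta> :: real assume "0 \<le> \<theta>" "\<theta> \<le> 2 * pi" "\<eta> \<le> \<bar>\<theta> - pi\<bar>"
    then have "cis \<theta> \<in> K" using in_K[of 1 \<theta>] by simp
    from H0_one[OF this] p(2)[OF this] p0 show "norm (H (cis \<theta>) - 1) \<le> \<epsilon>"
      using norm_triangle_ineq4[of "p (cis \<theta>) - 1" "p 0"]
        norm_triangle_ineq4[of "H0 (cis \<theta>) - 1" "H0 (cis \<theta>) - p (cis \<theta>)"]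
      by (simp add: H_def \<delta>_def algebra_simps)
  qed
qed

section \<open>Prescribed radial boundary values\<close>

text \<open>On the unit circle \<open>cnj z = 1 / z\<close>, so the real and imaginary parts of
  \<open>z\<close> are Laurent polynomials; sums and products preserve the form of an entire
  numerator over a power of \<open>z\<close>.\<close>

lemma laurent_real_polynomial_on_circle:
  assumes "real_polynomial_function (p :: complex \<Rightarrow> real)"
  shows "\<exists>Q M. Q holomorphic_on UNIV \<and> (\<forall>z\<in>sphere 0 1. of_real (p z) = Q z / z ^ (M::nat))"
  using assms
proof induction
  case (linear f)
  interpret bounded_linear f by fact
  define a b :: complex where "a = of_real (f 1)" and "b = of_real (f \<i>)"
  have "of_real (f z) = (a * ((z * z + 1) / 2) + b * ((z * z - 1) / (2 * \<i>))) / z ^ 1"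
    if "z \<in> sphere 0 1" for z
  proof -
    have "z \<noteq> 0" using that by auto
    moreover have "z * cnj z = 1" using that complex_norm_square[of z] by simp
    ultimately have z: "z \<noteq> 0" "cnj z = 1 / z" by (simp_all add: field_simps)
    have "f z = f (Re z *\<^sub>R 1 + Im z *\<^sub>R \<i>)"
      by (intro arg_cong[of _ _ f]) (auto simp: complex_eq_iff)
    also have "\<dots> = Re z * f 1 + Im z * f \<i>" by (simp add: add scaleR)
    finally have "of_real (f z) = a * of_real (Re z) + b * of_real (Im z)"
      by (simp add: a_def b_def)
    moreover have "of_real (Re z) = (z + 1 / z) / 2"
      using complex_add_cnj[of z] z by (simp add: field_simps)
    moreover have "of_real (Im z) = (z - 1 / z) / (2 * \<i>)"
      using complex_diff_cnj[of z] z by (simp add: field_simps)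
    ultimately have "of_real (f z) = a * ((z + 1 / z) / 2) + b * ((z - 1 / z) / (2 * \<i>))" by simp
    also have "\<dots> = (a * ((z * z + 1) / 2) + b * ((z * z - 1) / (2 * \<i>))) / z ^ 1"
      using z(1) by (simp add: field_simps)
    finally show ?thesis .
  qed
  then show ?case by (intro exI[of _ "\<lambda>z. a * ((z * z + 1) / 2) + b * ((z * z - 1) / (2 * \<i>))"]
        exI[of _ 1]) (auto intro!: holomorphic_intros)
next
  case (const c)
  then show ?case by (intro exI[of _ "\<lambda>_. of_real c"] exI[of _ 0]) auto
next
  case (add f g)
  then obtain P K Q M where "P holomorphic_on UNIV" "Q holomorphic_on UNIV"
    "\<forall>z\<in>sphere 0 1. of_real (f z) = P z / z ^ (K::nat)" "\<forall>z\<in>sphere 0 1. of_real (g z) = Q z / z ^ (M::nat)"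
    by blast
  moreover have "P z / z ^ K + Q z / z ^ M = (P z * z ^ M + Q z * z ^ K) / z ^ (K + M)"
    if "z \<in> sphere 0 1" for z
    using that by (subst add_frac_eq) (auto simp: power_add)
  ultimately show ?case
    by (intro exI[of _ "\<lambda>z. P z * z ^ M + Q z * z ^ K"] exI[of _ "K + M"])
      (auto intro!: holomorphic_intros)
next
  case (mult f g)
  then obtain P K Q M where "P holomorphic_on UNIV" "Q holomorphic_on UNIV"
    "\<forall>z\<in>sphere 0 1. of_real (f z) = P z / z ^ (K::nat)" "\<forall>z\<in>sphere 0 1. of_real (g z) = Q z / z ^ (M::nat)"
    by blast
  then show ?case
    by (intro exI[of _ "\<lambda>z. P z * Q z"] exI[of _ "K + M"])
      (auto intro!: holomorphic_intros simp: power_add)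
qed

lemma laurent_approximation_on_circle:
  assumes "continuous_on (sphere 0 1) (g :: complex \<Rightarrow> complex)" "e > 0"
  obtains Q M where "Q holomorphic_on UNIV" "\<And>z. norm z = 1 \<Longrightarrow> norm (g z - Q z / z ^ (M::nat)) < e"
proof -
  obtain p where p: "polynomial_function p" "\<forall>z\<in>sphere 0 1. norm (g z - p z) < e"
    using Stone_Weierstrass_polynomial_function[OF compact_sphere assms] by blast
  then have "real_polynomial_function (\<lambda>z. Re (p z))" "real_polynomial_function (\<lambda>z. Im (p z))"
    using bounded_linear_Re bounded_linear_Im unfolding polynomial_function_def o_def by auto
  then obtain P K Q M where hol: "P holomorphic_on UNIV" "Q holomorphic_on UNIV" and
    eq: "\<And>z. norm z = 1 \<Longrightarrow> of_real (Re (p z)) = P z / z ^ (K::nat)"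
    "\<And>z. norm z = 1 \<Longrightarrow> of_real (Im (p z)) = Q z / z ^ (M::nat)"
    using laurent_real_polynomial_on_circle by (metis mem_sphere_0)
  have "p z = (P z * z ^ M + \<i> * (Q z * z ^ K)) / z ^ (K + M)" if "norm z = 1" for z
  proof -
    have "z \<noteq> 0" using that by auto
    have "p z = of_real (Re (p z)) + \<i> * of_real (Im (p z))" by (simp add: complex_eq)
    then show ?thesis using eq[OF that] \<open>z \<noteq> 0\<close> by (simp add: power_add field_simps)
  qed
  then show ?thesis
    using p(2) hol
    by (intro that[of "\<lambda>z. P z * z ^ M + \<i> * (Q z * z ^ K)" "K + M"])
      (auto intro!: holomorphic_intros)
qed

section \<open>Approximation along most radii\<close>

text \<open>The set \<open>A\<close> collects the arguments that \<open>z \<mapsto> z ^ N\<close>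
  sends into the sector of half-width \<open>\<eta>\<close> around the negative axis. It consists of
  \<open>N\<close> intervals of length \<open>2 * \<eta> / N\<close>, so its measure bound is
  independent of \<open>N\<close>, which can then be taken as large as desired.\<close>

lemma periodic_gap_set:
  assumes "0 < \<eta>" "\<eta> \<le> pi" "N > 0"
  obtains A where "A \<in> sets lborel" "emeasure lborel A \<le> ennreal (2 * \<eta>)"
    "\<And>s. s \<in> {0..2*pi} - A \<Longrightarrow> \<exists>\<theta>. 0 \<le> \<theta> \<and> \<theta> \<le> 2 * pi \<and> \<eta> \<le> \<bar>\<theta> - pi\<bar> \<and> cis (real N * s) = cis \<theta>"
proof -
  define I where "I k = {(pi - \<eta> + 2 * pi * real k) / real N<..<(pi + \<eta> + 2 * pi * real k) / real N}" for k
  show ?thesis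
  proof (rule that[of "\<Union>k<N. I k"])
    show "(\<Union>k<N. I k) \<in> sets lborel" by (auto simp: I_def)
    have "emeasure lborel (I k) = ennreal (2 * \<eta> / real N)" for k
    proof -
      have "(pi - \<eta> + 2 * pi * real k) / real N \<le> (pi + \<eta> + 2 * pi * real k) / real N"
        using assms by (intro divide_right_mono) auto
      then show ?thesis unfolding I_def
        by (simp add: diff_divide_distrib[symmetric])
    qed
    moreover have "emeasure lborel (\<Union>k<N. I k) \<le> (\<Sum>k<N. emeasure lborel (I k))"
      by (intro emeasure_subadditive_finite) (auto simp: I_def)
    ultimately have "emeasure lborel (\<Union>k<N. I k) \<le> (\<Sum>k<N. ennreal (2 * \<eta> / real N))" by simp
    also have "\<dots> = ennreal (\<Sum>k<N. 2 * \<eta> / real N)"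
      using assms by (intro sum_ennreal) auto
    also have "(\<Sum>k<N. 2 * \<eta> / real N) = 2 * \<eta>" using assms by simp
    finally show "emeasure lborel (\<Union>k<N. I k) \<le> ennreal (2 * \<eta>)" .
    fix s assume s: "s \<in> {0..2*pi} - (\<Union>k<N. I k)"
    define k where "k = nat \<lfloor>real N * s / (2 * pi)\<rfloor>"
    define \<theta> where "\<theta> = real N * s - 2 * pi * real k"
    have "0 \<le> real N * s / (2 * pi)" using s by auto
    then have "real k \<le> real N * s / (2 * pi)" "real N * s / (2 * pi) < real k + 1"
      unfolding k_def by linarith+
    then have \<theta>: "0 \<le> \<theta>" "\<theta> < 2 * pi" by (auto simp: \<theta>_def field_simps)
    have "cis (real N * s) = cis (\<theta> + 2 * pi * real k)" by (simp add: \<theta>_def)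
    also have "\<dots> = cis \<theta>" by (simp add: cis_mult[symmetric] cis_multiple_2pi)
    finally have cis: "cis (real N * s) = cis \<theta>" .
    have "\<eta> \<le> \<bar>\<theta> - pi\<bar>"
    proof (cases "k < N")
      case True
      then have "s \<notin> I k" using s by auto
      then show ?thesis using assms by (auto simp: I_def \<theta>_def field_simps)
    next
      case False
      \<comment> \<open>Only the endpoint \<open>s = 2 * pi\<close> yields \<open>k = N\<close>;
        there \<open>\<theta> = 0\<close>, which is far enough from \<open>pi\<close> because
        \<open>\<eta> \<le> pi\<close>.\<close>
      have "real N * s \<le> real N * (2 * pi)" using s by (intro mult_left_mono) auto
      moreover have "2 * pi * real N \<le> 2 * pi * real k" using False by (intro mult_left_mono) auto
      moreover have "real N * (2 * pi) = 2 * pi * real N" by simp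
      ultimately have "\<theta> = 0" using \<theta>(1) unfolding \<theta>_def by linarith
      then show ?thesis using assms by simp
    qed
    then show "\<exists>\<theta>. 0 \<le> \<theta> \<and> \<theta> \<le> 2 * pi \<and> \<eta> \<le> \<bar>\<theta> - pi\<bar> \<and> cis (real N * s) = cis \<theta>"
      using \<theta> cis by (intro exI[of _ \<theta>]) auto
  qed
qed

text \<open>The function is \<open>q z * H (z ^ N)\<close> with \<open>q\<close> a Laurent
  approximation of \<open>d\<close>. For large \<open>N\<close> the factor \<open>H (z ^ N)\<close>
  is negligible except in a thin annulus, where \<open>q\<close> is nearly constant along each
  radius; outside \<open>A\<close> the power \<open>z ^ N\<close> avoids the sector where
  \<open>H\<close> is uncontrolled.\<close>

lemma entire_radial_approximation:
  fixes d :: "complex \<Rightarrow> complex"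
  assumes cont: "continuous_on (sphere 0 1) d" and \<eta>: "0 < \<eta>" "\<eta> \<le> pi" and "\<epsilon> > 0"
    and r0: "0 < r0" "r0 < 1"
  obtains G A where "G holomorphic_on UNIV" "A \<in> sets lborel" "emeasure lborel A \<le> ennreal (2 * \<eta>)"
    "\<And>z. norm z \<le> r0 \<Longrightarrow> norm (G z) \<le> \<epsilon>"
    "\<And>s r. s \<in> {0..2*pi} - A \<Longrightarrow> 0 \<le> r \<Longrightarrow> r \<le> 1 \<Longrightarrow> norm (G (of_real r * cis s)) \<le> 2 * norm (d (cis s)) + \<epsilon>"
    "\<And>s. s \<in> {0..2*pi} - A \<Longrightarrow> norm (G (cis s) - d (cis s)) \<le> \<epsilon>"
proof -
  \<comment> \<open>Along a radius \<open>q\<close> deviates from \<open>d (cis s)\<close> by two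
    errors \<open>\<epsilon>1\<close>, and the bound 2 for \<open>H\<close> doubles them.\<close>
  define \<epsilon>1 where "\<epsilon>1 = \<epsilon> / 4"
  have \<epsilon>1: "\<epsilon>1 > 0" using \<open>\<epsilon> > 0\<close> by (simp add: \<epsilon>1_def)
  obtain Q and M :: nat where Q: "Q holomorphic_on UNIV" "\<And>z. norm z = 1 \<Longrightarrow> norm (d z - Q z / z ^ M) < \<epsilon>1"
    using laurent_approximation_on_circle[OF cont \<epsilon>1] by blast
  define q where "q z = Q z / z ^ M" for z
  define R where "R = cball (0::complex) 1 - ball 0 r0"
  have "compact R" unfolding R_def by (simp add: compact_diff)
  have "continuous_on R q"
    using r0 unfolding q_def R_def
    by (auto intro!: continuous_intros continuous_on_subset[OF holomorphic_on_imp_continuous_on[OF Q(1)]])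
  then obtain B where B: "B > 0" "\<And>z. r0 \<le> norm z \<Longrightarrow> norm z \<le> 1 \<Longrightarrow> norm (q z) \<le> B"
    using compact_imp_bounded[OF compact_continuous_image[OF _ \<open>compact R\<close>], of q]
    by (auto simp: bounded_pos R_def)
  obtain \<delta> where \<delta>: "\<delta> > 0" "\<And>z w. z \<in> R \<Longrightarrow> w \<in> R \<Longrightarrow> dist z w < \<delta> \<Longrightarrow> dist (q z) (q w) < \<epsilon>1"
    using compact_uniformly_continuous[OF \<open>continuous_on R q\<close> \<open>compact R\<close>] \<epsilon>1
    unfolding uniformly_continuous_on_def by metis
  \<comment> \<open>Points of modulus above \<open>\<kappa>\<close> lie within
    \<open>\<delta>\<close> of the end of their radius, so uniform continuity of \<open>q\<close>
    applies.\<close>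
  define \<kappa> where "\<kappa> = max r0 (1 - \<delta>/2)"
  have \<kappa>: "0 < \<kappa>" "\<kappa> < 1" "r0 \<le> \<kappa>" "1 - \<delta> < \<kappa>" using r0 \<delta> by (auto simp: \<kappa>_def max_def)
  define \<epsilon>2 where "\<epsilon>2 = min 1 (\<epsilon>1 / B)"
  have \<epsilon>2: "0 < \<epsilon>2" "\<epsilon>2 \<le> 1" "B * \<epsilon>2 \<le> \<epsilon>1" using \<epsilon>1 B by (auto simp: \<epsilon>2_def min_def field_simps)
  obtain \<rho> H where H: "\<rho> > 0" "H holomorphic_on UNIV" "H 0 = 0"
    "\<And>z. norm z \<le> \<rho> \<Longrightarrow> norm (H z) \<le> \<epsilon>2"
    "\<And>x \<theta>. 0 \<le> x \<Longrightarrow> x \<le> 1 \<Longrightarrow> 0 \<le> \<theta> \<Longrightarrow> \<theta> \<le> 2 * pi \<Longrightarrow> \<eta> \<le> \<bar>\<theta> - pi\<bar> \<Longrightarrow>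
       norm (H (of_real x * cis \<theta>)) \<le> 2"
    "\<And>\<theta>. 0 \<le> \<theta> \<Longrightarrow> \<theta> \<le> 2 * pi \<Longrightarrow> \<eta> \<le> \<bar>\<theta> - pi\<bar> \<Longrightarrow> norm (H (cis \<theta>) - 1) \<le> \<epsilon>2"
    using entire_step_function[OF \<eta>(1) \<epsilon>2(1,2)] by metis
  obtain n0 where n0: "\<kappa> ^ n0 < \<rho>" using real_arch_pow_inv[OF H(1) \<kappa>(2)] by blast
  \<comment> \<open>Being at least \<open>n0\<close> makes \<open>\<kappa> ^ N \<le> \<rho>\<close>;
    exceeding \<open>M\<close> lets the zero of \<open>H (z ^ N)\<close> at 0 cancel the pole of
    \<open>q\<close>.\<close>
  define N where "N = max n0 (Suc M)"
  have N: "M < N" "N > 0" by (auto simp: N_def)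
  have "\<kappa> ^ N \<le> \<kappa> ^ n0" using \<kappa> by (intro power_decreasing) (auto simp: N_def)
  then have \<kappa>N: "\<kappa> ^ N \<le> \<rho>" using n0 by linarith
  obtain A where A: "A \<in> sets lborel" "emeasure lborel A \<le> ennreal (2 * \<eta>)"
    "\<And>s. s \<in> {0..2*pi} - A \<Longrightarrow> \<exists>\<theta>. 0 \<le> \<theta> \<and> \<theta> \<le> 2 * pi \<and> \<eta> \<le> \<bar>\<theta> - pi\<bar> \<and> cis (real N * s) = cis \<theta>"
    using periodic_gap_set[OF \<eta> N(2)] by metis
  \<comment> \<open>This is \<open>H z / z\<close> with the singularity removed; it makes
    \<open>G\<close> visibly entire, with value 0 at the origin.\<close>
  define H2 where "H2 z = (if z = 0 then deriv H 0 else (H z - H 0) / (z - 0))" for z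
  have H2: "H2 holomorphic_on UNIV"
    unfolding H2_def by (rule pole_lemma[OF H(2)]) auto
  have zH2: "z * H2 z = H z" for z using H(3) by (auto simp: H2_def)
  define G where "G z = z ^ (N - M) * Q z * H2 (z ^ N)" for z
  have G_hol: "G holomorphic_on UNIV"
  proof -
    have "(\<lambda>z. H2 (z ^ N)) holomorphic_on UNIV"
      using holomorphic_on_compose_gen[OF _ H2, of "\<lambda>z. z ^ N" UNIV]
      by (simp add: o_def holomorphic_on_power)
    then show ?thesis unfolding G_def by (intro holomorphic_intros Q)
  qed
  have G_eq: "G z = q z * H (z ^ N)" if "z \<noteq> 0" for z
  proof -
    have "z ^ N = z ^ (N - M) * z ^ M" using N by (simp flip: power_add)
    then show ?thesis using that by (simp add: G_def q_def flip: zH2)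
  qed
  \<comment> \<open>Near 0 the bound on \<open>q\<close> fails, so the estimate is made on the
    circle of radius \<open>\<kappa>\<close> and carried inside by the maximum principle.\<close>
  have G_small: "norm (G z) \<le> \<epsilon>1" if "norm z \<le> \<kappa>" for z
  proof (rule maximum_modulus_frontier[of G "cball 0 \<kappa>" \<epsilon>1 z])
    show "G holomorphic_on interior (cball 0 \<kappa>)" "continuous_on (closure (cball 0 \<kappa>)) G"
      using G_hol holomorphic_on_subset holomorphic_on_imp_continuous_on continuous_on_subset by blast+
    show "bounded (cball (0::complex) \<kappa>)" "z \<in> cball 0 \<kappa>" using that by auto
    fix w :: complex assume "w \<in> frontier (cball 0 \<kappa>)"
    then have w: "norm w = \<kappa>" using \<kappa> by auto
    then have "norm (q w) \<le> B" "norm (H (w ^ N)) \<le> \<epsilon>2"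
      using B(2)[of w] H(4)[of "w ^ N"] \<kappa> \<kappa>N by (auto simp: norm_power)
    then have "norm (q w) * norm (H (w ^ N)) \<le> B * \<epsilon>2" by (intro mult_mono) (use B in auto)
    then show "norm (G w) \<le> \<epsilon>1"
      using \<epsilon>2 G_eq[of w] w \<kappa> by (auto simp: norm_mult)
  qed
  show ?thesis
  proof (rule that[OF G_hol A(1,2)])
    show "norm (G z) \<le> \<epsilon>" if "norm z \<le> r0" for z
      using G_small[of z] that \<kappa> \<epsilon>1 by (auto simp: \<epsilon>1_def)
  next
    fix s r :: real assume s: "s \<in> {0..2*pi} - A" and r: "0 \<le> r" "r \<le> 1"
    define z where "z = of_real r * cis s"
    have nz: "norm z = r" using r by (simp add: z_def norm_mult)
    obtain \<theta> where \<theta>: "0 \<le> \<theta>" "\<theta> \<le> 2 * pi" "\<eta> \<le> \<bar>\<theta> - pi\<bar>" "cis (real N * s) = cis \<theta>"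
      using A(3)[OF s] by blast
    show "norm (G (of_real r * cis s)) \<le> 2 * norm (d (cis s)) + \<epsilon>"
    proof (cases "r \<le> \<kappa>")
      case True
      then have "norm (G z) \<le> \<epsilon>" using G_small[of z] nz \<epsilon>1 by (simp add: \<epsilon>1_def)
      moreover have "0 \<le> 2 * norm (d (cis s))" by simp
      ultimately show ?thesis unfolding z_def by linarith
    next
      case False
      have "z ^ N = of_real (r ^ N) * cis \<theta>" by (simp add: z_def power_mult_distrib Complex.DeMoivre \<theta>(4))
      then have "norm (H (z ^ N)) \<le> 2" using H(5)[of "r ^ N" \<theta>] r \<theta> by (simp add: power_le_one)
      have "z \<in> R" "cis s \<in> R" using nz r r0 False \<kappa> by (auto simp: R_def)
      moreover have "dist z (cis s) < \<delta>"
      proof -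
        have "z - cis s = of_real (r - 1) * cis s" by (simp add: z_def algebra_simps)
        then have "dist z (cis s) = \<bar>r - 1\<bar>" by (simp add: dist_norm norm_mult del: of_real_diff)
        then show ?thesis using False \<kappa> r by linarith
      qed
      ultimately have "norm (q z - q (cis s)) < \<epsilon>1" using \<delta>(2) by (auto simp: dist_norm)
      then have "norm (q z) \<le> norm (q (cis s)) + \<epsilon>1" using norm_triangle_sub[of "q z" "q (cis s)"] by simp
      moreover have "norm (q (cis s)) \<le> norm (d (cis s)) + \<epsilon>1"
        using Q(2)[of "cis s"] norm_triangle_sub[of "q (cis s)" "d (cis s)"]
        by (simp add: q_def norm_minus_commute)
      moreover have "norm (q z) * norm (H (z ^ N)) \<le> norm (q z) * 2"
        using \<open>norm (H (z ^ N)) \<le> 2\<close> by (intro mult_left_mono) auto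
      moreover have "z \<noteq> 0" using nz False \<kappa> by auto
      ultimately show ?thesis
        using G_eq[of z] by (simp add: z_def[symmetric] norm_mult \<epsilon>1_def)
    qed
  next
    fix s :: real assume s: "s \<in> {0..2*pi} - A"
    obtain \<theta> where \<theta>: "0 \<le> \<theta>" "\<theta> \<le> 2 * pi" "\<eta> \<le> \<bar>\<theta> - pi\<bar>" "cis (real N * s) = cis \<theta>"
      using A(3)[OF s] by blast
    have "norm (H (cis s ^ N) - 1) \<le> \<epsilon>2" unfolding Complex.DeMoivre \<theta>(4) by (rule H(6)[OF \<theta>(1-3)])
    moreover have "norm (q (cis s)) \<le> B" using B(2)[of "cis s"] r0 by simp
    ultimately have "norm (q (cis s)) * norm (H (cis s ^ N) - 1) \<le> B * \<epsilon>2"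
      by (intro mult_mono) (use B in auto)
    then have "norm (q (cis s) * (H (cis s ^ N) - 1)) \<le> \<epsilon>1" using \<epsilon>2 by (simp add: norm_mult)
    moreover have "norm (q (cis s) - d (cis s)) < \<epsilon>1"
      using Q(2)[of "cis s"] by (simp add: q_def norm_minus_commute)
    moreover have "G (cis s) - d (cis s) = q (cis s) * (H (cis s ^ N) - 1) + (q (cis s) - d (cis s))"
      using G_eq[of "cis s"] by (simp add: algebra_simps)
    ultimately have "norm (G (cis s) - d (cis s)) \<le> \<epsilon>1 + \<epsilon>1"
      using norm_triangle_mono less_imp_le by metis
    then show "norm (G (cis s) - d (cis s)) \<le> \<epsilon>" using \<epsilon>1 by (simp add: \<epsilon>1_def)
  qed
qed

section \<open>Continuous approximation of measurable boundary data\<close>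

text \<open>\<open>Arg2pi\<close> jumps at 1, so continuity of \<open>f \<circ> Arg2pi\<close> is
  read off from closed preimages: each is the image under \<open>cis\<close> of a compact subset of
  the closed interval.\<close>

lemma continuous_on_circle_of_periodic:
  fixes f :: "real \<Rightarrow> complex"
  assumes f: "continuous_on {0..2*pi} f" "f 0 = f (2*pi)"
  obtains k where "continuous_on (sphere 0 1) k" "\<And>s. s \<in> {0..2*pi} \<Longrightarrow> k (cis s) = f s"
proof
  define k where "k z = f (Arg2pi z)" for z
  show eq: "k (cis s) = f s" if "s \<in> {0..2*pi}" for s
  proof (cases "s = 2 * pi")
    case True
    then show ?thesis using f(2) Arg2pi_of_real[of 1] by (simp add: k_def)
  next
    case False
    then have "Arg2pi (cis s) = s"
      using that by (intro Arg2pi_unique[of 1]) (auto simp: cis_conv_exp mult.commute)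
    then show ?thesis by (simp add: k_def)
  qed
  show "continuous_on (sphere 0 1) k"
  proof (subst continuous_on_closed_vimage, simp, intro allI impI)
    fix C :: "complex set" assume "closed C"
    have "k -` C \<inter> sphere 0 1 = cis ` ({0..2*pi} \<inter> f -` C)"
    proof (intro set_eqI iffI)
      fix z assume z: "z \<in> k -` C \<inter> sphere 0 1"
      then have "z = cis (Arg2pi z)" using Arg2pi_eq[of z] by (simp add: cis_conv_exp)
      moreover have "Arg2pi z \<in> {0..2*pi}"
        using Arg2pi_ge_0[of z] Arg2pi_lt_2pi[of z] by auto
      ultimately show "z \<in> cis ` ({0..2*pi} \<inter> f -` C)" using z by (auto simp: k_def)
    next
      fix z assume "z \<in> cis ` ({0..2*pi} \<inter> f -` C)"
      then show "z \<in> k -` C \<inter> sphere 0 1" using eq by auto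
    qed
    moreover have "compact ({0..2*pi} \<inter> f -` C)"
      using continuous_closed_preimage[OF f(1) _ \<open>closed C\<close>]
      by (auto simp: compact_eq_bounded_closed intro: bounded_subset[OF bounded_closed_interval])
    moreover have "continuous_on ({0..2*pi} \<inter> f -` C) cis" by (intro continuous_intros)
    ultimately show "closed (k -` C \<inter> sphere 0 1)"
      using compact_continuous_image compact_imp_closed by metis
  qed
qed

text \<open>A measurable function is an almost everywhere limit of continuous ones. Cutting these
  off near the endpoints makes them periodic, and continuity of the finite measure from above bounds
  the set where the error exceeds \<open>e\<close>.\<close>

lemma measurable_approx_continuous_on_circle:
  fixes h :: "real \<Rightarrow> complex"
  assumes h: "h \<in> borel_measurable (lebesgue_on {0..2*pi})" and "e > 0"
  obtains k B where "continuous_on (sphere 0 1) k" "B \<in> sets (lebesgue_on {0..2*pi})"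
    "emeasure (lebesgue_on {0..2*pi}) B \<le> ennreal e"
    "\<And>s. s \<in> {0..2*pi} - B \<Longrightarrow> norm (k (cis s) - h s) \<le> e"
proof -
  define S where "S = {0..2*pi}"
  define M where "M = lebesgue_on S"
  interpret finite_measure M
    by (auto intro!: finite_measureI simp: M_def S_def emeasure_restrict_space)
  have hM[measurable]: "h \<in> borel_measurable M" using h by (simp add: M_def S_def)
  have "h measurable_on S"
    using h by (subst measurable_on_iff_borel_measurable) (auto simp: S_def)
  then obtain N g where N: "negligible N" "\<And>n. continuous_on UNIV (g n)"
    "\<And>x. x \<notin> N \<Longrightarrow> (\<lambda>n. g n x) \<longlonglongrightarrow> (if x \<in> S then h x else 0)"
    unfolding measurable_on_def by metis
  \<comment> \<open>The cutoff vanishes at both endpoints and is eventually 1 at each interior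
    point, so only two points of convergence are lost.\<close>
  define f where "f n s = of_real (min 1 (real n * min s (2*pi - s))) * g n s" for n :: nat and s
  have f_cont: "continuous_on UNIV (f n)" for n
    unfolding f_def by (intro continuous_intros N(2))
  have f_meas[measurable]: "f n \<in> borel_measurable M" for n
    unfolding M_def using continuous_on_subset[OF f_cont]
    by (intro continuous_imp_measurable_on_sets_lebesgue) (auto simp: S_def)
  have lim: "(\<lambda>n. f n s) \<longlonglongrightarrow> h s" if "s \<in> S" "s \<notin> N" "0 < s" "s < 2*pi" for s
  proof -
    define m where "m = min s (2*pi - s)"
    have "m > 0" using that by (simp add: m_def)
    obtain n0 :: nat where "real n0 > 1 / m" using reals_Archimedean2 by blast
    then have "f n s = g n s" if "n \<ge> n0" for n
    proof -
      have "real n \<ge> 1 / m" using that \<open>real n0 > 1 / m\<close> by linarith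
      then have "real n * m \<ge> 1" using \<open>m > 0\<close> by (simp add: field_simps)
      then show ?thesis by (simp add: f_def m_def[symmetric])
    qed
    then have "eventually (\<lambda>n. f n s = g n s) sequentially" by (auto simp: eventually_sequentially)
    then show ?thesis using N(3)[OF that(2)] that(1) tendsto_cong by fastforce
  qed
  \<comment> \<open>Including all later errors makes the sets decreasing; a point in their
    intersection is one where \<open>f n\<close> does not converge to \<open>h\<close>.\<close>
  define D where "D n = {s \<in> space M. \<exists>j\<in>{n..}. e < norm (f j s - h s)}" for n
  have D_sets: "D n \<in> sets M" for n
    unfolding D_def by measurable
  have "decseq D" by (auto simp: decseq_def D_def intro: order_trans)
  have "(\<lambda>n. emeasure M (D n)) \<longlonglongrightarrow> emeasure M (\<Inter>n. D n)"
    using D_sets \<open>decseq D\<close> by (intro Lim_emeasure_decseq) auto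
  moreover have "emeasure M (\<Inter>n. D n) = 0"
  proof -
    have "negligible (S \<inter> (N \<union> {0, 2*pi}))" using N(1) by (intro negligible_Int) simp
    then have "S \<inter> (N \<union> {0, 2*pi}) \<in> null_sets lebesgue" by (simp add: negligible_iff_null_sets)
    then have "S \<inter> (N \<union> {0, 2*pi}) \<in> null_sets M"
      unfolding M_def by (subst null_sets_restrict_space) (auto simp: S_def)
    moreover have "(\<Inter>n. D n) \<subseteq> S \<inter> (N \<union> {0, 2*pi})"
    proof
      fix s assume s: "s \<in> (\<Inter>n. D n)"
      then have "s \<in> S" by (auto simp: D_def M_def)
      have "\<not> (\<lambda>n. f n s) \<longlonglongrightarrow> h s"
      proof
        assume "(\<lambda>n. f n s) \<longlonglongrightarrow> h s"
        then obtain n where "\<forall>j\<ge>n. norm (f j s - h s) < e" using \<open>e > 0\<close> by (meson LIMSEQ_D)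
        moreover have "s \<in> D n" using s by blast
        ultimately show False by (auto simp: D_def)
      qed
      then have "s \<in> N \<or> \<not> (0 < s \<and> s < 2*pi)" using lim[OF \<open>s \<in> S\<close>] by blast
      then have "s \<in> N \<or> s = 0 \<or> s = 2*pi" using \<open>s \<in> S\<close> by (auto simp: S_def)
      then show "s \<in> S \<inter> (N \<union> {0, 2*pi})" using \<open>s \<in> S\<close> by blast
    qed
    moreover have "(\<Inter>n. D n) \<in> sets M"
      using D_sets by (intro sets.countable_INT) auto
    ultimately have "(\<Inter>n. D n) \<in> null_sets M"
      by (meson null_sets_subset)
    then show ?thesis by blast
  qed
  ultimately have "(\<lambda>n. emeasure M (D n)) \<longlonglongrightarrow> 0" by simp
  then have "eventually (\<lambda>n. emeasure M (D n) < ennreal e) sequentially"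
    using \<open>e > 0\<close> by (intro order_tendstoD(2)) auto
  then obtain n where n: "emeasure M (D n) < ennreal e" by (auto simp: eventually_sequentially)
  obtain k where k: "continuous_on (sphere 0 1) k" "\<And>s. s \<in> {0..2*pi} \<Longrightarrow> k (cis s) = f n s"
    using continuous_on_circle_of_periodic[of "f n"] continuous_on_subset[OF f_cont] by (auto simp: f_def)
  show ?thesis
  proof (rule that[OF k(1), of "D n"])
    show "D n \<in> sets (lebesgue_on {0..2*pi})" "emeasure (lebesgue_on {0..2*pi}) (D n) \<le> ennreal e"
      using D_sets[of n] n by (auto simp: M_def S_def)
    fix s assume "s \<in> {0..2*pi} - D n"
    then show "norm (k (cis s) - h s) \<le> e"
      using k(2)[of s] by (auto simp: D_def M_def S_def not_less)
  qed
qed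

section \<open>Summation of the corrections\<close>

text \<open>The partial sums \<open>S n\<close> are chosen recursively, since each correction aims
  at the error left by its predecessors. The bounds \<open>(1/2) ^ n\<close> make both the
  corrections on good radii and the measures of the exceptional sets summable.\<close>

theorem radial_boundary_values:
  fixes h :: "real \<Rightarrow> complex"
  assumes h: "h \<in> borel_measurable (lebesgue_on {0..2*pi})"
  obtains \<Phi> and X :: "nat \<Rightarrow> real set" where "\<Phi> holomorphic_on ball 0 1"
    "AE s in lebesgue_on {0..2*pi}. \<exists>m. s \<in> X m"
    "\<And>m. continuous_on {of_real r * cis s | r s. r \<in> {0..1} \<and> s \<in> X m} \<Phi>"
    "\<And>m s. s \<in> X m \<Longrightarrow> \<Phi> (cis s) = h s"
proof -
  define M where "M = lebesgue_on {0..2*pi}"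
  have "\<forall>n::nat. \<exists>k B. continuous_on (sphere 0 1) k \<and> B \<in> sets M \<and> emeasure M B \<le> ennreal ((1/2)^n) \<and>
    (\<forall>s \<in> {0..2*pi} - B. norm (k (cis s) - h s) \<le> (1/2)^n)"
  proof
    fix n :: nat
    have "(1/2::real)^n > 0" by simp
    from measurable_approx_continuous_on_circle[OF h this]
    show "\<exists>k B. continuous_on (sphere 0 1) k \<and> B \<in> sets M \<and> emeasure M B \<le> ennreal ((1/2)^n) \<and>
      (\<forall>s \<in> {0..2*pi} - B. norm (k (cis s) - h s) \<le> (1/2)^n)"
      unfolding M_def by metis
  qed
  then obtain k B where k: "\<And>n::nat. continuous_on (sphere 0 1) (k n)" and
    B: "\<And>n. B n \<in> sets M" "\<And>n. emeasure M (B n) \<le> ennreal ((1/2)^n)" and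
    kB: "\<And>n s. s \<in> {0..2*pi} - B n \<Longrightarrow> norm (k n (cis s) - h s) \<le> (1/2)^n"
    by metis
  \<comment> \<open>Radii tending to 1, so that every compact subset of the disk lies in all but
    finitely many of the disks where the corrections are tiny.\<close>
  define r where "r n = 1 - 1 / (real n + 2)" for n
  have r: "0 < r n" "r n < 1" for n by (auto simp: r_def field_simps)
  define Q where "Q n S A S' \<longleftrightarrow> A \<in> sets lborel \<and> emeasure lborel A \<le> ennreal (2 * (1/2)^n) \<and>
     (\<forall>z. norm z \<le> r n \<longrightarrow> norm (S' z - S z) \<le> (1/2)^n) \<and>
     (\<forall>s\<in>{0..2*pi} - A. \<forall>x\<in>{0..1}. norm (S' (of_real x * cis s) - S (of_real x * cis s))
         \<le> 2 * norm (k n (cis s) - S (cis s)) + (1/2)^n) \<and>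
     (\<forall>s\<in>{0..2*pi} - A. norm (S' (cis s) - k n (cis s)) \<le> (1/2)^n)"
    for n and S S' :: "complex \<Rightarrow> complex" and A
  \<comment> \<open>The clause for \<open>n = 0\<close> starts the recursion at the zero function,
    so that the telescoping series has partial sums exactly \<open>S n\<close>.\<close>
  have "\<exists>S. \<forall>n. (S n holomorphic_on UNIV \<and> (n = 0 \<longrightarrow> S n = (\<lambda>_. 0))) \<and> (\<exists>A. Q n (S n) A (S (Suc n)))"
  proof (rule dependent_nat_choice)
    show "\<exists>S. S holomorphic_on UNIV \<and> ((0::nat) = 0 \<longrightarrow> S = (\<lambda>_. 0))" by auto
    fix S :: "complex \<Rightarrow> complex" and n :: nat
    assume "S holomorphic_on UNIV \<and> (n = 0 \<longrightarrow> S = (\<lambda>_. 0))"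
    then have S: "S holomorphic_on UNIV" by simp
    have cont: "continuous_on (sphere 0 1) (\<lambda>z. k n z - S z)"
      by (intro continuous_intros k continuous_on_subset[OF holomorphic_on_imp_continuous_on[OF S]]) auto
    have e: "0 < (1/2::real)^n" "(1/2::real)^n \<le> pi"
      using pi_ge_two power_le_one[of "1/2::real" n] by (simp, linarith)
    obtain G A where G: "G holomorphic_on UNIV" "A \<in> sets lborel" "emeasure lborel A \<le> ennreal (2 * (1/2)^n)"
      "\<And>z. norm z \<le> r n \<Longrightarrow> norm (G z) \<le> (1/2)^n"
      "\<And>s x. s \<in> {0..2*pi} - A \<Longrightarrow> 0 \<le> x \<Longrightarrow> x \<le> 1 \<Longrightarrow>
          norm (G (of_real x * cis s)) \<le> 2 * norm (k n (cis s) - S (cis s)) + (1/2)^n"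
      "\<And>s. s \<in> {0..2*pi} - A \<Longrightarrow> norm (G (cis s) - (k n (cis s) - S (cis s))) \<le> (1/2)^n"
      using entire_radial_approximation[OF cont e e(1) r(1,2)] by metis
    have "Q n S A (\<lambda>z. S z + G z)"
      unfolding Q_def using G(2-) by (auto simp: algebra_simps)
    then show "\<exists>S'. (S' holomorphic_on UNIV \<and> (Suc n = 0 \<longrightarrow> S' = (\<lambda>_. 0))) \<and> (\<exists>A. Q n S A S')"
      using G(1) S by (intro exI[of _ "\<lambda>z. S z + G z"]) (auto intro!: holomorphic_intros)
  qed
  then obtain S A where S: "\<And>n. S n holomorphic_on UNIV" "S 0 = (\<lambda>_. 0)"
    and QA: "\<And>n. Q n (S n) (A n) (S (Suc n))" by metis
  have A: "A n \<in> sets lborel" "emeasure lborel (A n) \<le> ennreal (2 * (1/2)^n)" for n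
    using QA[of n] unfolding Q_def by auto
  have S_small: "norm (S (Suc n) z - S n z) \<le> (1/2)^n" if "norm z \<le> r n" for n z
    using QA[of n] that unfolding Q_def by auto
  have S_ray: "norm (S (Suc n) (of_real x * cis s) - S n (of_real x * cis s))
         \<le> 2 * norm (k n (cis s) - S n (cis s)) + (1/2)^n"
    if "s \<in> {0..2*pi} - A n" "x \<in> {0..1}" for n s x
    using QA[of n] that unfolding Q_def by auto
  have S_circle: "norm (S (Suc n) (cis s) - k n (cis s)) \<le> (1/2)^n"
    if "s \<in> {0..2*pi} - A n" for n s
    using QA[of n] that unfolding Q_def by auto
  define bad where "bad n = B n \<union> ({0..2*pi} \<inter> A n)" for n
  define X where "X m = {s\<in>{0..2*pi}. \<forall>n\<ge>m. s \<notin> bad n}" for m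
  define \<Phi> where "\<Phi> z = (\<Sum>i. S (Suc i) z - S i z)" for z
  have psum: "(\<Sum>i<n. S (Suc i) z - S i z) = S n z" for n z
    using sum_lessThan_telescope[of "\<lambda>i. S i z" n] S(2) by simp
  have summ: "summable (\<lambda>n. c * (1/2::real)^n)" for c
    by (intro summable_mult summable_geometric) auto
  have bad_sets: "bad n \<in> sets M" for n
  proof -
    have "A n \<in> sets lebesgue" using A(1)[of n] by auto
    then have "{0..2*pi} \<inter> A n \<in> sets M" by (auto simp: M_def sets_restrict_space)
    then show ?thesis unfolding bad_def by (intro sets.Un B)
  qed
  have bad_meas: "emeasure M (bad n) \<le> ennreal (3 * (1/2)^n)" for n
  proof -
    have An: "A n \<in> sets lebesgue" using A(1)[of n] by auto
    have "{0..2*pi} \<inter> A n \<in> sets M" using An by (auto simp: M_def sets_restrict_space)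
    then have "emeasure M (bad n) \<le> emeasure M (B n) + emeasure M ({0..2*pi} \<inter> A n)"
      unfolding bad_def by (intro emeasure_subadditive B)
    also have "emeasure M ({0..2*pi} \<inter> A n) = emeasure lebesgue ({0..2*pi} \<inter> A n)"
      unfolding M_def by (rule emeasure_restrict_space) auto
    also have "\<dots> \<le> emeasure lebesgue (A n)" using An by (intro emeasure_mono Int_lower2)
    also have "emeasure lebesgue (A n) = emeasure lborel (A n)" using A(1) by simp
    also have "\<dots> \<le> ennreal (2 * (1/2)^n)" by (rule A)
    also have "emeasure M (B n) + ennreal (2 * (1/2)^n) \<le> ennreal ((1/2)^n) + ennreal (2 * (1/2)^n)"
      by (intro add_right_mono B)
    also have "\<dots> = ennreal (3 * (1/2)^n)" by (subst ennreal_plus[symmetric]) auto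
    finally show ?thesis by (simp add: add_left_mono)
  qed
  show ?thesis
  proof (rule that[of \<Phi> X])
    \<comment> \<open>Borel-Cantelli: almost every argument lies in only finitely many exceptional
      sets, hence in some \<open>X m\<close>.\<close>
    have "AE s in M. eventually (\<lambda>n. s \<in> space M - bad n) sequentially"
    proof (rule borel_cantelli_AE1[OF bad_sets])
      show "emeasure M (bad n) < \<infinity>" for n
        using bad_meas[of n] by (simp add: le_less_trans)
      have "norm (measure M (bad n)) \<le> 3 * (1/2)^n" for n
        using bad_meas[of n] by (simp add: measure_def enn2real_leI)
      then show "summable (\<lambda>n. measure M (bad n))"
        by (intro summable_comparison_test[OF _ summ[of 3]]) auto
    qed
    then show "AE s in lebesgue_on {0..2*pi}. \<exists>m. s \<in> X m"
      unfolding M_def[symmetric]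
      by eventually_elim (auto simp: X_def eventually_sequentially M_def)
    show "\<Phi> holomorphic_on ball 0 1"
    proof (rule holomorphic_uniform_sequence[of _ S])
      show "open (ball (0::complex) 1)" by simp
      show "S n holomorphic_on ball 0 1" for n using S(1) holomorphic_on_subset by blast
      fix x :: complex assume x: "x \<in> ball 0 1"
      define d where "d = (1 - norm x) / 2"
      have d: "d > 0" "norm x + d < 1" using x by (auto simp: d_def field_simps)
      have "uniform_limit (cball x d) (\<lambda>n z. \<Sum>i<n. S (Suc i) z - S i z) \<Phi> sequentially"
        unfolding \<Phi>_def
      proof (rule Weierstrass_m_test_ev)
        show "summable (\<lambda>n. 1 * (1/2::real)^n)" by (rule summ)
        have "r \<longlonglongrightarrow> 1" unfolding r_def by real_asymp
        then have "eventually (\<lambda>n. norm x + d < r n) sequentially"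
          using d by (intro order_tendstoD(1))
        then show "\<forall>\<^sub>F n in sequentially. \<forall>z\<in>cball x d. norm (S (Suc n) z - S n z) \<le> 1 * (1/2)^n"
        proof eventually_elim
          case (elim n)
          have "norm z \<le> r n" if "z \<in> cball x d" for z
            using that elim norm_triangle_sub[of z x] by (simp add: dist_norm norm_minus_commute)
          then show ?case using S_small by simp
        qed
      qed
      moreover have "cball x d \<subseteq> ball 0 1"
      proof
        fix z assume "z \<in> cball x d"
        then show "z \<in> ball 0 1"
          using d norm_triangle_sub[of z x] by (simp add: dist_norm norm_minus_commute)
      qed
      ultimately show "\<exists>d>0. cball x d \<subseteq> ball 0 1 \<and> uniform_limit (cball x d) S \<Phi> sequentially"
        using d by (auto simp: psum)
    qed
  next
    fix m
    define Y where "Y = {of_real x * cis s | x s. x \<in> {0..1} \<and> s \<in> X m}"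
    \<comment> \<open>Bounding the error \<open>k n - S n\<close> uses the step before, which also
      must be good; hence the start at \<open>Suc m\<close>. Since \<open>(1/2) ^ n'\<close> is
      twice \<open>(1/2) ^ n\<close>, the error is at most 5, thus 6, times
      \<open>(1/2) ^ n\<close>, and \<open>13 = 2 * 6 + 1\<close>.\<close>
    have diff: "norm (S (Suc n) z - S n z) \<le> 13 * (1/2)^n" if z: "z \<in> Y" and n: "n \<ge> Suc m" for z n
    proof -
      obtain x s where z: "z = of_real x * cis s" "x \<in> {0..1}" "s \<in> X m" using z by (auto simp: Y_def)
      obtain n' where n': "n = Suc n'" "n' \<ge> m" using n by (cases n) auto
      have s: "s \<in> {0..2*pi} - A n" "s \<in> {0..2*pi} - A n'" "s \<in> {0..2*pi} - B n" "s \<in> {0..2*pi} - B n'"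
        using z(3) n' by (auto simp: X_def bad_def)
      have "norm (k n (cis s) - S n (cis s)) \<le> norm (k n (cis s) - h s) + norm (k n' (cis s) - h s)
          + norm (S n (cis s) - k n' (cis s))"
        using norm_triangle_ineq4[of "k n (cis s) - h s" "k n' (cis s) - h s"]
          norm_triangle_ineq4[of "k n (cis s) - k n' (cis s)" "S n (cis s) - k n' (cis s)"] by simp
      also have "\<dots> \<le> (1/2)^n + (1/2)^n' + (1/2)^n'"
        using kB[OF s(3)] kB[OF s(4)] S_circle[OF s(2)] by (simp add: n'(1))
      also have "\<dots> \<le> 6 * (1/2)^n" by (simp add: n'(1))
      finally show ?thesis using S_ray[OF s(1) z(2)] unfolding z(1) by linarith
    qed
    have lim: "uniform_limit Y (\<lambda>n z. \<Sum>i<n. S (Suc i) z - S i z) \<Phi> sequentially"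
      unfolding \<Phi>_def
      by (rule Weierstrass_m_test_ev[OF _ summ[of 13]]) (use diff in \<open>auto simp: eventually_sequentially\<close>)
    then have lim: "uniform_limit Y S \<Phi> sequentially" by (simp add: psum)
    show "continuous_on {of_real r * cis s | r s. r \<in> {0..1} \<and> s \<in> X m} \<Phi>"
      unfolding Y_def[symmetric]
    proof (rule uniform_limit_theorem[OF _ lim])
      show "\<forall>\<^sub>F n in sequentially. continuous_on Y (S n)"
        using S(1) holomorphic_on_imp_continuous_on continuous_on_subset by (intro always_eventually) blast
    qed auto
    fix s assume s: "s \<in> X m"
    then have "cis s \<in> Y" unfolding Y_def
      by (intro CollectI exI[of _ "1::real"] exI[of _ s]) auto
    then have "(\<lambda>n. S n (cis s)) \<longlonglongrightarrow> \<Phi> (cis s)" using lim by (rule tendsto_uniform_limitI[rotated])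
    \<comment> \<open>The index is shifted because it is \<open>S (Suc n)\<close> that is close to
      \<open>k n\<close> on the circle.\<close>
    then have 1: "(\<lambda>n. S (Suc n) (cis s)) \<longlonglongrightarrow> \<Phi> (cis s)" by (rule LIMSEQ_Suc)
    have "(\<lambda>n. S (Suc n) (cis s) - h s) \<longlonglongrightarrow> 0"
    proof (rule Lim_null_comparison)
      show "\<forall>\<^sub>F n in sequentially. norm (S (Suc n) (cis s) - h s) \<le> 2 * (1/2)^n"
        using eventually_ge_at_top[of m]
      proof eventually_elim
        case (elim n)
        then have s': "s \<in> {0..2*pi} - A n" "s \<in> {0..2*pi} - B n"
          using s by (auto simp: X_def bad_def)
        show ?case
          using norm_triangle_ineq[of "S (Suc n) (cis s) - k n (cis s)" "k n (cis s) - h s"]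
            S_circle[OF s'(1)] kB[OF s'(2)] by simp
      qed
      show "(\<lambda>n. 2 * (1/2)^n :: real) \<longlonglongrightarrow> 0" by real_asymp
    qed
    then have "(\<lambda>n. S (Suc n) (cis s)) \<longlonglongrightarrow> h s" by (simp add: LIM_zero_iff)
    then show "\<Phi> (cis s) = h s" using 1 LIMSEQ_unique by blast
  qed
qed

section \<open>Cluster sets along curves\<close>

text \<open>A rational chosen in the gap to the right of each such point determines it, because no
  other point of \<open>X\<close> lies between the point and its rational.\<close>

lemma countable_right_isolated:
  fixes X :: "real set"
  shows "countable {t\<in>X. \<exists>\<delta>>0. X \<inter> {t<..<t + \<delta>} = {}}" (is "countable ?Z")
proof -
  have "\<forall>t\<in>?Z. \<exists>q\<in>\<rat>. t < q \<and> X \<inter> {t<..q} = {}"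
  proof
    fix t assume "t \<in> ?Z"
    then obtain \<delta> where "\<delta> > 0" "X \<inter> {t<..<t + \<delta>} = {}" by blast
    moreover then obtain q where "q \<in> \<rat>" "t < q" "q < t + \<delta>"
      using Rats_dense_in_real[of t "t + \<delta>"] by auto
    ultimately show "\<exists>q\<in>\<rat>. t < q \<and> X \<inter> {t<..q} = {}"
      by (intro bexI[of _ q]) auto
  qed
  from bchoice[OF this[unfolded Bex_def]]
  obtain q where q: "\<And>t. t \<in> ?Z \<Longrightarrow> q t \<in> \<rat> \<and> t < q t \<and> X \<inter> {t<..q t} = {}" by blast
  have "inj_on q ?Z"
  proof (rule linorder_inj_onI')
    fix s t assume st: "s \<in> ?Z" "t \<in> ?Z" "s < t"
    then have "t \<notin> {s<..q s}" using q[OF st(1)] by blast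
    then show "q s \<noteq> q t" using q[OF st(2)] st(3) by auto
  qed
  moreover have "countable (q ` ?Z)"
    by (rule countable_subset[OF _ countable_rat]) (use q in blast)
  ultimately show ?thesis using countable_image_inj_on by blast
qed

lemma countable_left_isolated:
  fixes X :: "real set"
  shows "countable {t\<in>X. \<exists>\<delta>>0. X \<inter> {t - \<delta><..<t} = {}}" (is "countable ?Z")
proof -
  have "?Z \<subseteq> uminus ` {t\<in>uminus ` X. \<exists>\<delta>>0. uminus ` X \<inter> {t<..<t + \<delta>} = {}}"
  proof
    fix t assume t: "t \<in> ?Z"
    then obtain \<delta> where \<delta>: "\<delta> > 0" "X \<inter> {t - \<delta><..<t} = {}" by blast
    have "uminus ` X \<inter> {-t<..<-t + \<delta>} = {}"
    proof (rule ccontr)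
      assume "uminus ` X \<inter> {-t<..<-t + \<delta>} \<noteq> {}"
      then obtain x where "x \<in> X" "- t < - x" "- x < - t + \<delta>" by auto
      then have "x \<in> X \<inter> {t - \<delta><..<t}" by auto
      then show False using \<delta> by blast
    qed
    then show "t \<in> uminus ` {t\<in>uminus ` X. \<exists>\<delta>>0. uminus ` X \<inter> {t<..<t + \<delta>} = {}}"
      using t \<delta>(1) by (intro image_eqI[of _ _ "-t"]) auto
  qed
  then show ?thesis
    by (rule countable_subset) (intro countable_image countable_right_isolated)
qed

text \<open>By the intermediate value theorem for the argument, a curve ending at the boundary point
  with argument \<open>t\<close> meets, arbitrarily late, one of the radii over a set that accumulates at
  \<open>t\<close> from both sides.\<close>

lemma curve_meets_radii:
  assumes \<beta>: "continuous_on {0..1} \<beta>" "\<beta> 1 = cis t" "\<And>x. x \<in> {0..1} \<Longrightarrow> norm (\<beta> x) \<le> 1"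
    and t: "0 < t" "t < 2*pi" "t \<in> X"
    and right: "\<And>\<delta>. \<delta> > 0 \<Longrightarrow> X \<inter> {t<..<t + \<delta>} \<noteq> {}"
    and left: "\<And>\<delta>. \<delta> > 0 \<Longrightarrow> X \<inter> {t - \<delta><..<t} \<noteq> {}"
    and "\<delta> > (0::real)"
  shows "\<exists>x. 0 \<le> x \<and> 1 - \<delta> < x \<and> x < 1 \<and> \<beta> x \<in> {of_real r * cis s | r s. r \<in> {0..1} \<and> s \<in> X}"
proof -
  have Arg_t: "Arg2pi (cis t) = t"
    using t by (intro Arg2pi_unique[of 1]) (auto simp: cis_conv_exp mult.commute)
  \<comment> \<open>Away from the nonnegative real axis \<open>Arg2pi\<close> is continuous, so the
    argument is continuous along a tail of the curve.\<close>
  have "cis t \<notin> \<real>\<^sub>\<ge>\<^sub>0"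
    using Arg_t Arg2pi_eq_0[of "cis t"] t by (auto simp: complex_nonneg_Reals_iff complex_is_Real_iff)
  moreover have "((\<beta> \<longlongrightarrow> cis t) (at 1 within {0..1}))"
    using \<beta>(1,2) unfolding continuous_on_def by (metis atLeastAtMost_iff order_refl zero_le_one)
  ultimately have "eventually (\<lambda>x. \<beta> x \<in> - \<real>\<^sub>\<ge>\<^sub>0) (at 1 within {0..1})"
    by (intro topological_tendstoD) (auto simp: open_Compl)
  then obtain d where d: "d > 0" "\<And>x. x \<in> {0..1} \<Longrightarrow> x \<noteq> 1 \<Longrightarrow> dist x 1 < d \<Longrightarrow> \<beta> x \<notin> \<real>\<^sub>\<ge>\<^sub>0"
    by (auto simp: eventually_at)
  define x1 where "x1 = max 0 (max (1 - d/2) (1 - \<delta>/2))"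
  have x1: "0 \<le> x1" "x1 < 1" "1 - \<delta> < x1" "1 - d < x1"
    using d \<open>\<delta> > 0\<close> by (auto simp: x1_def)
  define \<alpha> where "\<alpha> x = Arg2pi (\<beta> x)" for x
  have "\<beta> x \<notin> \<real>\<^sub>\<ge>\<^sub>0" if "x \<in> {x1..1}" for x
    using d(2)[of x] that x1 \<open>cis t \<notin> \<real>\<^sub>\<ge>\<^sub>0\<close> \<beta>(2) by (cases "x = 1") (auto simp: dist_real_def)
  then have "continuous_on (\<beta> ` {x1..1}) Arg2pi"
    by (intro continuous_at_imp_continuous_on) (auto intro: continuous_at_Arg2pi)
  then have cont: "continuous_on {x1..1} \<alpha>"
    unfolding \<alpha>_def using x1 by (intro continuous_on_compose2[OF _ continuous_on_subset[OF \<beta>(1)]]) auto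
  have \<alpha>1: "\<alpha> 1 = t" using Arg_t \<beta>(2) by (simp add: \<alpha>_def)
  \<comment> \<open>The argument moves from \<open>\<alpha> x1\<close> to \<open>t\<close>. If these
    differ, \<open>X\<close> has a point strictly between them, which is attained before parameter
    1; if they agree, \<open>x1\<close> itself serves because \<open>t \<in> X\<close>.\<close>
  have "\<exists>x\<in>{x1..<1}. \<alpha> x \<in> X"
  proof (cases "\<alpha> x1" t rule: linorder_cases)
    case less
    then obtain s where "s \<in> X" "\<alpha> x1 < s" "s < t" using left[of "t - \<alpha> x1"] by auto
    moreover then obtain x where "x1 \<le> x" "x \<le> 1" "\<alpha> x = s"
      using IVT'[of \<alpha> x1 s 1] cont \<alpha>1 x1 by auto
    ultimately show ?thesis using \<alpha>1 by (intro bexI[of _ x]) (auto simp: less_le)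
  next
    case equal
    then show ?thesis using t x1 by auto
  next
    case greater
    then obtain s where "s \<in> X" "s < \<alpha> x1" "t < s" using right[of "\<alpha> x1 - t"] by auto
    moreover then obtain x where "x1 \<le> x" "x \<le> 1" "\<alpha> x = s"
      using IVT2'[of \<alpha> 1 s x1] cont \<alpha>1 x1 by auto
    ultimately show ?thesis using \<alpha>1 by (intro bexI[of _ x]) (auto simp: less_le)
  qed
  then obtain x where x: "x1 \<le> x" "x < 1" "\<alpha> x \<in> X" by auto
  have "\<beta> x = of_real (norm (\<beta> x)) * cis (\<alpha> x)"
    using Arg2pi_eq[of "\<beta> x"] by (simp add: \<alpha>_def cis_conv_exp)
  moreover have "norm (\<beta> x) \<in> {0..1}" using \<beta>(3)[of x] x x1 by simp
  ultimately have "\<beta> x \<in> {of_real r * cis s | r s. r \<in> {0..1} \<and> s \<in> X}" using x(3) by blast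
  then show ?thesis using x x1 by (intro exI[of _ x]) auto
qed

section \<open>Transport to the Jordan domain\<close>

theorem theorem4p1:
  fixes D :: "complex set" and \<omega> :: "complex \<Rightarrow> complex"
    and lam :: "complex \<Rightarrow> complex" and \<phi> :: "complex \<Rightarrow> real"
  assumes "jordan_domain D"
    and "conformal_ext_map D \<omega>"
    and "\<forall>\<zeta>\<in>frontier D. norm (lam \<zeta>) = 1"
    and "harm_measurable_fun D \<omega> lam"
    and "harm_measurable_fun D \<omega> \<phi>"
  shows "\<exists>f. f analytic_on D \<and>
           (\<exists>N. N \<subseteq> frontier D \<and> harm_null D \<omega> N \<and>
              (\<forall>\<zeta>\<in>frontier D - N.
                 principal_asymptotic_values (\<lambda>z. complex_of_real (Re (cnj (lam \<zeta>) * f z))) D \<zeta>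
                   = {Some (complex_of_real (\<phi> \<zeta>))}))"
proof -
  have "open D"
    using assms(1) unfolding jordan_domain_def
    by (metis closed_path_image open_inside simple_path_imp_path)
  obtain g where hol: "\<omega> holomorphic_on D" and \<omega>D: "\<omega> ` D = ball 0 1"
    and hom: "homeomorphism (closure D) (cball 0 1) \<omega> g"
    using assms(2) unfolding conformal_ext_map_def by blast
  have g\<omega>: "g (\<omega> z) = z" if "z \<in> closure D" for z
    using hom that by (simp add: homeomorphism_apply1)
  have \<omega>g: "\<omega> (g w) = w" if "w \<in> cball 0 1" for w
    using hom that by (simp add: homeomorphism_apply2)
  have \<omega>_cont: "continuous_on (closure D) \<omega>" and g_cont: "continuous_on (cball 0 1) g"
    and \<omega>_im: "\<omega> ` closure D = cball 0 1"
    using hom by (auto simp: homeomorphism_def)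
  have inv: "inv_into (closure D) \<omega> (\<omega> z) = z" if "z \<in> closure D" for z
    by (rule inv_into_f_f) (use that g\<omega> in \<open>metis inj_onI\<close>)+
  have D_cl: "D \<subseteq> closure D" by (rule closure_subset)
  define I where "I t = inv_into (closure D) \<omega> (cis t)" for t
  \<comment> \<open>As \<open>lam\<close> is unimodular, multiplying this boundary value by
    \<open>cnj (lam \<zeta>)\<close> leaves the real number \<open>\<phi> \<zeta>\<close>.\<close>
  define h where "h t = lam (I t) * of_real (\<phi> (I t))" for t
  have "(\<lambda>t. complex_of_real (\<phi> (I t))) \<in> borel_measurable (lebesgue_on {0..2*pi})"
    using assms(5) borel_measurable_continuous_onI[OF continuous_on_of_real_id]
    unfolding harm_measurable_fun_def I_def by (rule measurable_compose)
  then have h_meas: "h \<in> borel_measurable (lebesgue_on {0..2*pi})"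
    using assms(4) unfolding harm_measurable_fun_def h_def I_def by (intro borel_measurable_times)
  obtain \<Phi> and X :: "nat \<Rightarrow> real set" where \<Phi>: "\<Phi> holomorphic_on ball 0 1"
    and AE: "AE s in lebesgue_on {0..2*pi}. \<exists>m. s \<in> X m"
    and cont: "\<And>m. continuous_on {of_real r * cis s | r s. r \<in> {0..1} \<and> s \<in> X m} \<Phi>"
    and \<Phi>h: "\<And>m s. s \<in> X m \<Longrightarrow> \<Phi> (cis s) = h s"
    by (rule radial_boundary_values[OF h_meas]) (rule that)
  \<comment> \<open>At these points of \<open>X m\<close> accumulation from one side fails, so the
    crossing argument for curves does not apply. There are only countably many.\<close>
  define one_sided where "one_sided m =
    {t\<in>X m. \<exists>\<delta>>0. X m \<inter> {t<..<t + \<delta>} = {}} \<union> {t\<in>X m. \<exists>\<delta>>0. X m \<inter> {t - \<delta><..<t} = {}}" for m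
  \<comment> \<open>The endpoints 0 and \<open>2 * pi\<close> are left out because the argument
    function jumps there.\<close>
  define T where "T = {t. 0 < t \<and> t < 2*pi \<and> (\<exists>m. t \<in> X m - one_sided m)}"
  define N where "N = {\<zeta>\<in>frontier D. \<not> (\<exists>t\<in>T. \<omega> \<zeta> = cis t)}"
  define f where "f z = \<Phi> (\<omega> z)" for z
  have "harm_null D \<omega> N"
  proof -
    have "countable ({0, 2*pi} \<union> (\<Union>m. one_sided m))"
      unfolding one_sided_def
      by (intro countable_Un countable_UN countable_right_isolated countable_left_isolated) auto
    then have 1: "({0, 2*pi} \<union> (\<Union>m. one_sided m)) \<in> null_sets lebesgue"
      by (intro null_sets_completionI countable_imp_null_set_lborel)
    have "AE s in lebesgue. s \<in> {0..2*pi} \<longrightarrow> (\<exists>m. s \<in> X m)"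
      using AE by (subst (asm) AE_restrict_space_iff) auto
    then have "{s. \<not> (s \<in> {0..2*pi} \<longrightarrow> (\<exists>m. s \<in> X m))} \<in> null_sets lebesgue"
      by (simp add: completion.AE_iff_null_sets)
    then have "{s. \<not> (s \<in> {0..2*pi} \<longrightarrow> (\<exists>m. s \<in> X m))} \<union> ({0, 2*pi} \<union> (\<Union>m. one_sided m)) \<in> null_sets lebesgue"
      using 1 by (rule null_sets.Un)
    moreover have "{t\<in>{0..2*pi}. cis t \<in> \<omega> ` N} \<subseteq>
        {s. \<not> (s \<in> {0..2*pi} \<longrightarrow> (\<exists>m. s \<in> X m))} \<union> ({0, 2*pi} \<union> (\<Union>m. one_sided m))"
    proof
      fix t assume t: "t \<in> {t\<in>{0..2*pi}. cis t \<in> \<omega> ` N}"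
      then have "t \<notin> T" by (auto simp: N_def)
      then show "t \<in> {s. \<not> (s \<in> {0..2*pi} \<longrightarrow> (\<exists>m. s \<in> X m))} \<union> ({0, 2*pi} \<union> (\<Union>m. one_sided m))"
        using t by (auto simp: T_def less_le)
    qed
    ultimately show ?thesis
      unfolding harm_null_def by (meson completion.complete2)
  qed
  moreover have "f analytic_on D"
    unfolding analytic_on_open[OF \<open>open D\<close>] f_def
    using holomorphic_on_compose_gen[OF hol \<Phi>] \<omega>D by (auto simp: o_def)
  moreover have "principal_asymptotic_values (\<lambda>z. complex_of_real (Re (cnj (lam \<zeta>) * f z))) D \<zeta>
                   = {Some (complex_of_real (\<phi> \<zeta>))}" (is "principal_asymptotic_values ?\<Omega> D \<zeta> = {?c}")
    if \<zeta>: "\<zeta> \<in> frontier D - N" for \<zeta>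
  proof -
    obtain t m where t: "\<omega> \<zeta> = cis t" "0 < t" "t < 2*pi" "t \<in> X m" "t \<notin> one_sided m"
      using \<zeta> by (auto simp: N_def T_def)
    define Y where "Y = {of_real r * cis s | r s. r \<in> {0..1} \<and> s \<in> X m}"
    have \<zeta>cl: "\<zeta> \<in> closure D" using \<zeta> by (simp add: frontier_def)
    have "I t = \<zeta>" using inv[OF \<zeta>cl] t(1) by (simp add: I_def)
    then have ht: "h t = lam \<zeta> * of_real (\<phi> \<zeta>)" by (simp add: h_def)
    have "norm (lam \<zeta>) = 1" using assms(3) \<zeta> by blast
    then have "cnj (lam \<zeta>) * lam \<zeta> = 1" using complex_norm_square[of "lam \<zeta>"] by (simp add: mult.commute)
    then have "cnj (lam \<zeta>) * h t = of_real (\<phi> \<zeta>)" unfolding ht by (simp flip: mult.assoc)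
    then have Re_h: "Re (cnj (lam \<zeta>) * h t) = \<phi> \<zeta>" by simp
    have tY: "cis t \<in> Y" unfolding Y_def using t(4) by (intro CollectI exI[of _ "1::real"] exI[of _ t]) auto
    \<comment> \<open>Continuity of \<open>\<Phi>\<close> on the radii over \<open>X m\<close>,
      including their endpoints, fixes the limit. This serves both inclusions: for crossing points
      of an arbitrary arc and for all points of the radial arc.\<close>
    have lim: "(\<lambda>n. ?\<Omega> (z n)) \<longlonglongrightarrow> of_real (\<phi> \<zeta>)"
      if z: "z \<longlonglongrightarrow> \<zeta>" "\<And>n. z n \<in> D" "\<And>n. \<omega> (z n) \<in> Y" for z
    proof -
      have "(\<lambda>n. \<omega> (z n)) \<longlonglongrightarrow> \<omega> \<zeta>"
        using D_cl z by (intro continuous_on_tendsto_compose[OF \<omega>_cont _ \<zeta>cl] always_eventually) auto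
      then have "(\<lambda>n. \<Phi> (\<omega> (z n))) \<longlonglongrightarrow> \<Phi> (\<omega> \<zeta>)"
        using z(3) tY t(1) cont[of m, folded Y_def]
        by (intro continuous_on_tendsto_compose[of Y \<Phi>] always_eventually) auto
      then have "(\<lambda>n. f (z n)) \<longlonglongrightarrow> h t" using \<Phi>h[OF t(4)] by (simp add: f_def t(1))
      then have "(\<lambda>n. ?\<Omega> (z n)) \<longlonglongrightarrow> of_real (Re (cnj (lam \<zeta>) * h t))"
        by (intro tendsto_intros)
      then show ?thesis by (simp only: Re_h)
    qed
    \<comment> \<open>The image of the arc under \<open>\<omega>\<close> crosses \<open>Y\<close>
      arbitrarily late; the crossing points form the sequence witnessing the cluster value.\<close>
    have "?c \<in> cluster_set_arc ?\<Omega> \<zeta> \<gamma>" if "arc_to D \<zeta> \<gamma>" for \<gamma>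
    proof -
      have \<gamma>: "continuous_on {0..1} \<gamma>" "\<gamma> 1 = \<zeta>" "\<And>x. x \<in> {0..<1} \<Longrightarrow> \<gamma> x \<in> D"
        using that by (auto simp: arc_to_def arc_def path_def pathfinish_def)
      have \<gamma>cl: "\<gamma> x \<in> closure D" if "x \<in> {0..1}" for x
        using \<gamma>(2,3) that \<zeta>cl D_cl by (cases "x = 1") auto
      have "\<exists>x. 0 \<le> x \<and> 1 - 1 / real (Suc n) < x \<and> x < 1 \<and> \<omega> (\<gamma> x) \<in> Y" for n
        unfolding Y_def
      proof (rule curve_meets_radii[OF _ _ _ t(2-4)])
        show "continuous_on {0..1} (\<lambda>x. \<omega> (\<gamma> x))"
          using \<gamma>cl by (intro continuous_on_compose2[OF \<omega>_cont \<gamma>(1)]) auto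
        show "norm (\<omega> (\<gamma> x)) \<le> 1" if "x \<in> {0..1}" for x
          using \<gamma>cl[OF that] \<omega>_im by (metis imageI mem_cball_0)
        show "X m \<inter> {t<..<t + \<delta>} \<noteq> {}" "X m \<inter> {t - \<delta><..<t} \<noteq> {}" if "\<delta> > 0" for \<delta>
          using t(4,5) that by (auto simp: one_sided_def)
      qed (use \<gamma>(2) t(1) in auto)
      then obtain x where x: "\<And>n. 0 \<le> x n \<and> 1 - 1 / real (Suc n) < x n \<and> x n < 1 \<and> \<omega> (\<gamma> (x n)) \<in> Y"
        by metis
      have "x \<longlonglongrightarrow> 1"
      proof (rule tendsto_sandwich)
        show "(\<lambda>n. 1 - 1 / real (Suc n)) \<longlonglongrightarrow> 1" by real_asymp
        show "eventually (\<lambda>n. 1 - 1 / real (Suc n) \<le> x n) sequentially" "eventually (\<lambda>n. x n \<le> 1) sequentially"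
          by (intro always_eventually allI less_imp_le conjunct1[OF conjunct2[OF x]]
              conjunct1[OF conjunct2[OF conjunct2[OF x]]])+
      qed simp
      then have "(\<lambda>n. \<gamma> (x n)) \<longlonglongrightarrow> \<gamma> 1"
        using x by (intro continuous_on_tendsto_compose[OF \<gamma>(1)]) (auto simp: less_imp_le)
      then have "(\<lambda>n. \<gamma> (x n)) \<longlonglongrightarrow> \<zeta>" using \<gamma>(2) by simp
      moreover from this have "(\<lambda>n. ?\<Omega> (\<gamma> (x n))) \<longlonglongrightarrow> of_real (\<phi> \<zeta>)"
        using x \<gamma>(3) by (intro lim) auto
      ultimately show ?thesis
        unfolding cluster_set_arc_def tends_ext_def using x
        by (intro CollectI exI[of _ "\<lambda>n. \<gamma> (x n)"]) auto
    qed
    \<comment> \<open>The preimage of the radius ending at \<open>cis t\<close> is an arc lying over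
      \<open>Y\<close>, so its cluster set contains no second value; intersecting with it gives
      uniqueness.\<close>
    moreover have "\<exists>\<gamma>. arc_to D \<zeta> \<gamma> \<and> cluster_set_arc ?\<Omega> \<zeta> \<gamma> \<subseteq> {?c}"
    proof (intro exI conjI)
      define \<gamma> where "\<gamma> x = g (of_real x * cis t)" for x
      have in_cball: "of_real x * cis t \<in> cball 0 1" if "x \<in> {0..1}" for x
        using that by (simp add: norm_mult)
      have \<omega>\<gamma>: "\<omega> (\<gamma> x) = of_real x * cis t" if "x \<in> {0..1}" for x
        using \<omega>g in_cball[OF that] by (simp add: \<gamma>_def)
      have \<gamma>D: "\<gamma> x \<in> D" if "x \<in> {0..<1}" for x
      proof -
        have "of_real x * cis t \<in> \<omega> ` D" unfolding \<omega>D using that by (simp add: norm_mult)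
        then show ?thesis using g\<omega> D_cl by (auto simp: \<gamma>_def)
      qed
      show "arc_to D \<zeta> \<gamma>"
        unfolding arc_to_def
      proof (intro conjI)
        have "path \<gamma>" unfolding path_def \<gamma>_def
          using in_cball by (intro continuous_on_compose2[OF g_cont] continuous_intros) auto
        moreover have "inj_on \<gamma> {0..1}"
        proof (rule inj_onI)
          fix x y :: real assume "x \<in> {0..1}" "y \<in> {0..1}" "\<gamma> x = \<gamma> y"
          then have "of_real x * cis t = of_real y * cis t" by (simp flip: \<omega>\<gamma>)
          then show "x = y" by simp
        qed
        ultimately show "arc \<gamma>" by (simp add: arc_def)
        show "pathfinish \<gamma> = \<zeta>" using g\<omega>[OF \<zeta>cl] t(1) by (simp add: pathfinish_def \<gamma>_def)
        show "\<gamma> ` {0..<1} \<subseteq> D" using \<gamma>D by blast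
      qed
      show "cluster_set_arc ?\<Omega> \<zeta> \<gamma> \<subseteq> {?c}"
      proof
        fix w assume "w \<in> cluster_set_arc ?\<Omega> \<zeta> \<gamma>"
        then obtain z where z: "\<And>n. z n \<in> \<gamma> ` {0..<1}" "z \<longlonglongrightarrow> \<zeta>" "tends_ext (\<lambda>n. ?\<Omega> (z n)) w"
          unfolding cluster_set_arc_def by blast
        have "z n \<in> D \<and> \<omega> (z n) \<in> Y" for n
        proof -
          obtain x where x: "x \<in> {0..<1}" "z n = \<gamma> x" using z(1)[of n] by blast
          moreover have "\<omega> (\<gamma> x) \<in> Y"
            using \<omega>\<gamma>[of x] x(1) t(4) unfolding Y_def by (intro CollectI exI[of _ x] exI[of _ t]) auto
          ultimately show ?thesis using \<gamma>D by simp
        qed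
        then have "(\<lambda>n. ?\<Omega> (z n)) \<longlonglongrightarrow> of_real (\<phi> \<zeta>)" using z(2) by (intro lim) auto
        note \<Omega>_lim = this
        show "w \<in> {?c}"
        proof (cases w)
          \<comment> \<open>The value infinity is excluded because the sequence has a finite
            limit.\<close>
          case None
          then have "filterlim (\<lambda>n. ?\<Omega> (z n)) at_infinity sequentially"
            using z(3) by (simp only: tends_ext_def option.case)
          then show ?thesis
            using not_tendsto_and_filterlim_at_infinity[OF sequentially_bot \<Omega>_lim] by blast
        next
          case (Some c)
          then have "(\<lambda>n. ?\<Omega> (z n)) \<longlonglongrightarrow> c"
            using z(3) by (simp only: tends_ext_def option.case)
          then show ?thesis using LIMSEQ_unique[OF \<Omega>_lim] Some by blast
        qed
      qed
    qed
    ultimately show ?thesis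
      unfolding principal_asymptotic_values_def by blast
  qed
  moreover have "N \<subseteq> frontier D" by (auto simp: N_def)
  ultimately show ?thesis by blast
qed

end
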